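(* Let $P\subset\mathbb{R}^3$ be a $3$-dimensional convex polytope (with the origin in its interior). If $P$ is first-order rigid, then $P$ has all edge length perturbations, i.e. the edge length map $\boldsymbol\ell:\mathrm{REAL}(\mathcal P)\to\mathbb{R}^E$ is locally surjective at $P$.
   Context: Let $P$ have vertex set $V$, edge set $E$ and facet set $F$, and write $i\sim\sigma$ if vertex $i$ lies on facet $\sigma$. The realization space of the combinatorial type $\mathcal P=(V,E,F,\sim)$ of $P$ is the set $\mathrm{REAL}(\mathcal P)\subset\mathbb{R}^{3V}\oplus\mathbb{R}^{3F}$ of pairs $(\boldsymbol p,\boldsymbol a)$ of maps $\boldsymbol p:V\to\mathbb{R}^3$, $\boldsymbol a:F\to\mathbb{R}^3$ with $\langle p_i,a_\sigma\rangle=1$ whenever $i\sim\sigma$ and $\langle p_i,a_\sigma\rangle<1$ whenever $i\not\sim\sigma$. $P$ is identified with the element $(\boldsymbol p,\boldsymbol a)$ of $\mathrm{REAL}(\mathcal P)$ given by its vertices and suitably scaled outward facet normals. A first-order motion of $P$ is a pair $(\dot{\boldsymbol p},\dot{\boldsymbol a})$ of maps $\dot{\boldsymbol p}:V\to\mathbb{R}^3$, $\dot{\boldsymbol a}:F\to\mathbb{R}^3$ with $\langle p_i-p_j,\dot p_i-\dot p_j\rangle=0$ for all $ij\in E$ and $\langle p_i,\dot a_\sigma\rangle+\langle\dot p_i,a_\sigma\rangle=0$ for all $i\sim\sigma$. It is trivial if $\langle p_i-p_j,\dot p_i-\dot p_j\rangle=0$ for all $i,j\in V$. $P$ is first-order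 rigid if all its first-order motions are trivial. The edge length map is $\boldsymbol\ell:\mathrm{REAL}(\mathcal P)\to\mathbb{R}^E$, $\boldsymbol\ell(\boldsymbol p,\boldsymbol a)=\big(\tfrac12\|p_i-p_j\|^2\big)_{ij\in E}$. Locally surjective at $P$ means: for every neighborhood $U$ of $P$ in $\mathrm{REAL}(\mathcal P)$, the image $\boldsymbol\ell(U)$ contains a neighborhood of $\boldsymbol\ell(P)$ in $\mathbb{R}^E$. *)

theory Defs
  imports "HOL-Analysis.Analysis"
begin

text \<open>A combinatorial type \<open>(V, E, F, \<sim>)\<close>. Edges are unordered pairs \<open>{i, j}\<close> of vertices.\<close>

record ('v, 'f) comb_type =
  vertices :: "'v set"
  edges :: "'v set set"
  facets :: "'f set"
  incident :: "'v \<Rightarrow> 'f \<Rightarrow> bool"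

text \<open>Maps \<open>V \<rightarrow> \<real>\<^sup>3\<close> and \<open>F \<rightarrow> \<real>\<^sup>3\<close> are represented by extensional functions, i.e. by the points
  of the corresponding product topologies.\<close>

type_synonym ('v, 'f) config = "('v \<Rightarrow> real^3) \<times> ('f \<Rightarrow> real^3)"

definition config_topology :: "('v, 'f) comb_type \<Rightarrow> ('v, 'f) config topology" where
  "config_topology C =
     prod_topology (product_topology (\<lambda>_. euclidean) (vertices C))
                   (product_topology (\<lambda>_. euclidean) (facets C))"

definition realization_space :: "('v, 'f) comb_type \<Rightarrow> ('v, 'f) config set" where
  "realization_space C =
     {(p, a). p \<in> vertices C \<rightarrow>\<^sub>E UNIV \<and> a \<in> facets C \<rightarrow>\<^sub>E UNIV \<and>
        (\<forall>i\<in>vertices C. \<forall>\<sigma>\<in>facets C.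
           (incident C i \<sigma> \<longrightarrow> p i \<bullet> a \<sigma> = 1) \<and> (\<not> incident C i \<sigma> \<longrightarrow> p i \<bullet> a \<sigma> < 1))}"

definition realization_topology :: "('v, 'f) comb_type \<Rightarrow> ('v, 'f) config topology" where
  "realization_topology C = subtopology (config_topology C) (realization_space C)"

definition first_order_motion ::
    "('v, 'f) comb_type \<Rightarrow> ('v, 'f) config \<Rightarrow> ('v, 'f) config \<Rightarrow> bool" where
  "first_order_motion C = (\<lambda>(p, a) (p', a').
     p' \<in> vertices C \<rightarrow>\<^sub>E UNIV \<and> a' \<in> facets C \<rightarrow>\<^sub>E UNIV \<and>
     (\<forall>i j. {i, j} \<in> edges C \<longrightarrow> (p i - p j) \<bullet> (p' i - p' j) = 0) \<and>
     (\<forall>i\<in>vertices C. \<forall>\<sigma>\<in>facets C. incident C i \<sigma> \<longrightarrow> p i \<bullet> a' \<sigma> + p' i \<bullet> a \<sigma> = 0))"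

definition trivial_motion ::
    "('v, 'f) comb_type \<Rightarrow> ('v, 'f) config \<Rightarrow> ('v, 'f) config \<Rightarrow> bool" where
  "trivial_motion C = (\<lambda>(p, a) (p', a').
     \<forall>i\<in>vertices C. \<forall>j\<in>vertices C. (p i - p j) \<bullet> (p' i - p' j) = 0)"

definition first_order_rigid_config :: "('v, 'f) comb_type \<Rightarrow> ('v, 'f) config \<Rightarrow> bool" where
  "first_order_rigid_config C r \<longleftrightarrow>
     (\<forall>m. first_order_motion C r m \<longrightarrow> trivial_motion C r m)"

text \<open>The description does not depend on the order of the end points, see \<open>half_sq_length_pair\<close>.\<close>

definition half_sq_length :: "('v \<Rightarrow> real^3) \<Rightarrow> 'v set \<Rightarrow> real" where
  "half_sq_length p e = (THE l. \<exists>i j. e = {i, j} \<and> l = (1/2) * (norm (p i - p j))\<^sup>2)"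

lemma half_sq_length_pair: "half_sq_length p {i, j} = (1/2) * (norm (p i - p j))\<^sup>2"
  unfolding half_sq_length_def
  by (rule the_equality) (auto simp: doubleton_eq_iff norm_minus_commute)

definition edge_length_map :: "('v, 'f) comb_type \<Rightarrow> ('v, 'f) config \<Rightarrow> 'v set \<Rightarrow> real" where
  "edge_length_map C = (\<lambda>(p, a). \<lambda>e\<in>edges C. half_sq_length p e)"

definition neighbourhood_in :: "'a topology \<Rightarrow> 'a \<Rightarrow> 'a set \<Rightarrow> bool" where
  "neighbourhood_in X x U \<longleftrightarrow> U \<subseteq> topspace X \<and> (\<exists>W. openin X W \<and> x \<in> W \<and> W \<subseteq> U)"

definition locally_surjective_at ::
    "'a topology \<Rightarrow> 'b topology \<Rightarrow> ('a \<Rightarrow> 'b) \<Rightarrow> 'a \<Rightarrow> bool" where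
  "locally_surjective_at X Y f x \<longleftrightarrow>
     (\<forall>U. neighbourhood_in X x U \<longrightarrow> (\<exists>N. neighbourhood_in Y (f x) N \<and> N \<subseteq> f ` U))"

definition polytope_type :: "(real^3) set \<Rightarrow> (real^3, (real^3) set) comb_type" where
  "polytope_type P =
     \<lparr>vertices = {v. v extreme_point_of P},
      edges = {{i, j} | i j. closed_segment i j edge_of P},
      facets = {\<sigma>. \<sigma> facet_of P},
      incident = (\<in>)\<rparr>"

text \<open>The outward normal of \<open>\<sigma>\<close>, scaled such that \<open>\<sigma>\<close> is cut out by \<open>a \<bullet> x = 1\<close>. It exists and is
  unique if \<open>P\<close> is a 3-polytope with the origin in its interior, see \<open>facet_normal\<close>.\<close>

definition facet_normal :: "(real^3) set \<Rightarrow> (real^3) set \<Rightarrow> real^3" where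
  "facet_normal P \<sigma> = (THE a. P \<subseteq> {x. a \<bullet> x \<le> 1} \<and> \<sigma> = P \<inter> {x. a \<bullet> x = 1})"

definition polytope_config :: "(real^3) set \<Rightarrow> (real^3, (real^3) set) config" where
  "polytope_config P =
     ((\<lambda>v\<in>vertices (polytope_type P). v), (\<lambda>\<sigma>\<in>facets (polytope_type P). facet_normal P \<sigma>))"

definition first_order_rigid :: "(real^3) set \<Rightarrow> bool" where
  "first_order_rigid P \<longleftrightarrow> first_order_rigid_config (polytope_type P) (polytope_config P)"

definition has_all_edge_length_perturbations :: "(real^3) set \<Rightarrow> bool" where
  "has_all_edge_length_perturbations P \<longleftrightarrow>
     locally_surjective_at
       (realization_topology (polytope_type P))
       (product_topology (\<lambda>_. euclideanreal) (edges (polytope_type P)))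
       (edge_length_map (polytope_type P))
       (polytope_config P)"

lemma topspace_realization_topology: "topspace (realization_topology C) = realization_space C"
  by (auto simp: realization_topology_def config_topology_def realization_space_def)

lemma facet_normal_unique:
  fixes a b :: "real^3"
  assumes "aff_dim \<sigma> = 2" "\<sigma> \<subseteq> {x. a \<bullet> x = 1}" "\<sigma> \<subseteq> {x. b \<bullet> x = 1}"
  shows "a = b"
proof -
  have ne: "\<sigma> \<noteq> {}" using assms(1) by auto
  have nz: "a \<noteq> 0" "b \<noteq> 0" using assms ne by auto
  have hull: "affine hull \<sigma> = {x. c \<bullet> x = 1}" if "c \<noteq> 0" "\<sigma> \<subseteq> {x. c \<bullet> x = 1}" for c
  proof (rule affine_dim_equal)
    show "affine hull \<sigma> \<subseteq> {x. c \<bullet> x = 1}" using that by (simp add: affine_hyperplane hull_minimal)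
    show "aff_dim (affine hull \<sigma>) = aff_dim {x. c \<bullet> x = 1}" using that assms(1) by simp
  qed (use ne in \<open>auto simp: affine_hyperplane\<close>)
  have eq: "{x. a \<bullet> x = 1} = {x. b \<bullet> x = 1}" using hull nz assms by metis
  have aa: "a \<bullet> a \<noteq> 0" using nz by simp
  define x0 where "x0 = (1 / (a \<bullet> a)) *\<^sub>R a"
  have x0: "a \<bullet> x0 = 1" using aa by (simp add: x0_def)
  then have bx0: "b \<bullet> x0 = 1" using eq by blast
  define y where "y = b - ((b \<bullet> a) / (a \<bullet> a)) *\<^sub>R a"
  have ay: "a \<bullet> y = 0" using aa by (simp add: y_def inner_diff_right inner_commute)
  have "a \<bullet> (x0 + y) = 1" using x0 ay by (simp add: inner_add_right)
  then have "b \<bullet> (x0 + y) = 1" using eq by blast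
  then have by0: "b \<bullet> y = 0" using bx0 by (simp add: inner_add_right)
  have "y \<bullet> y = b \<bullet> y - ((b \<bullet> a) / (a \<bullet> a)) * (a \<bullet> y)"
    by (subst (1) y_def) (simp add: inner_diff_left)
  then have "y = 0" using ay by0 by simp
  moreover have "(b \<bullet> a) / (a \<bullet> a) = 1"
    using bx0 unfolding x0_def inner_scaleR_right by (simp only: times_divide_eq_left mult_1_left)
  ultimately show ?thesis by (simp add: y_def)
qed

lemma facet_normal:
  assumes "polytope P" "aff_dim P = 3" "0 \<in> interior P" "\<sigma> facet_of P"
  shows "P \<subseteq> {x. facet_normal P \<sigma> \<bullet> x \<le> 1}" "\<sigma> = P \<inter> {x. facet_normal P \<sigma> \<bullet> x = 1}"
proof -
  obtain c d where c: "c \<noteq> 0" "P \<subseteq> {x. c \<bullet> x \<le> d}" "\<sigma> = P \<inter> {x. c \<bullet> x = d}"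
    using facet_of_polyhedron assms polytope_imp_polyhedron by metis
  have "interior P \<subseteq> interior {x. c \<bullet> x \<le> d}" using c by (intro interior_mono)
  then have d: "d > 0" using c assms by auto
  have ex: "P \<subseteq> {x. ((1/d) *\<^sub>R c) \<bullet> x \<le> 1} \<and> \<sigma> = P \<inter> {x. ((1/d) *\<^sub>R c) \<bullet> x = 1}"
    using c d by (auto simp: field_simps)
  have dim: "aff_dim \<sigma> = 2" using assms by (simp add: facet_of_def)
  have "\<exists>!a. P \<subseteq> {x. a \<bullet> x \<le> 1} \<and> \<sigma> = P \<inter> {x. a \<bullet> x = 1}"
  proof (rule ex_ex1I)
    show "\<exists>a. P \<subseteq> {x. a \<bullet> x \<le> 1} \<and> \<sigma> = P \<inter> {x. a \<bullet> x = 1}" using ex by blast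
    show "a = b" if "P \<subseteq> {x. a \<bullet> x \<le> 1} \<and> \<sigma> = P \<inter> {x. a \<bullet> x = 1}"
      "P \<subseteq> {x. b \<bullet> x \<le> 1} \<and> \<sigma> = P \<inter> {x. b \<bullet> x = 1}" for a b
      using that facet_normal_unique[OF dim, of a b] by blast
  qed
  from theI'[OF this]
  show "P \<subseteq> {x. facet_normal P \<sigma> \<bullet> x \<le> 1}" "\<sigma> = P \<inter> {x. facet_normal P \<sigma> \<bullet> x = 1}"
    unfolding facet_normal_def by blast+
qed

lemma polytope_config_in_realization_space:
  assumes "polytope P" "aff_dim P = 3" "0 \<in> interior P"
  shows "polytope_config P \<in> realization_space (polytope_type P)"
proof -
  have "(v \<in> \<sigma> \<longrightarrow> v \<bullet> facet_normal P \<sigma> = 1) \<and> (v \<notin> \<sigma> \<longrightarrow> v \<bullet> facet_normal P \<sigma> < 1)"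
    if "v extreme_point_of P" "\<sigma> facet_of P" for v \<sigma>
  proof -
    have "v \<in> P" using that by (simp add: extreme_point_of_def)
    then show ?thesis using facet_normal[OF assms that(2)]
      by (auto simp: inner_commute less_le)
  qed
  then show ?thesis
    by (auto simp: polytope_config_def realization_space_def polytope_type_def)
qed

end

theory Submission
  imports Defs
begin

text \<open>The realization space is cut out near \<open>P\<close> by the quadratic equations \<open>\<langle>p\<^sub>i, a\<^sub>\<sigma>\<rangle> = 1\<close>, one per incidence,
  and open conditions. Adjoining the half squared edge lengths gives a quadratic map \<open>\<Phi>\<close> whose
  derivative at \<open>P\<close> has the first-order motions as its kernel. If \<open>P\<close> is rigid, six further linear
  functionals, which normalize away the infinitesimal isometries, make this derivative injective.
  By Euler's formula there are at most as many equations (\<open>E + 2 E + 6\<close>) as unknowns (\<open>3 V + 3 F\<close>), so the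
  derivative is surjective, and \<open>\<Phi>\<close> can be solved near \<open>P\<close> by Picard iteration along a linear right
  inverse of the derivative.

  Only the inequality \<open>E + 2 \<le> V + F\<close> is needed. It is obtained by sweeping \<open>P\<close> with a generic linear
  functional: a vertex which is neither the lowest nor the highest is the top of at least \<open>d - 1\<close>
  facets, where \<open>d\<close> is the number of edges descending from it.\<close>

section \<open>Square linear systems\<close>

lemma underdetermined_system:
  fixes A :: "'k \<Rightarrow> 'i \<Rightarrow> 'a::field"
  assumes "finite K" "finite I" "card K < card I"
  shows "\<exists>x. (\<exists>i\<in>I. x i \<noteq> 0) \<and> (\<forall>k\<in>K. (\<Sum>i\<in>I. A k i * x i) = 0)"
  using assms
proof (induction K arbitrary: A I rule: finite_induct)
  case empty
  then obtain i where "i \<in> I" by fastforce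
  then show ?case by (intro exI[of _ "\<lambda>_. 1"]) auto
next
  case (insert k K)
  show ?case
  proof (cases "\<forall>i\<in>I. A k i = 0")
    case True
    have "\<exists>x. (\<exists>i\<in>I. x i \<noteq> 0) \<and> (\<forall>k\<in>K. (\<Sum>i\<in>I. A k i * x i) = 0)"
      using insert.prems insert.hyps by (intro insert.IH) auto
    moreover have "(\<Sum>i\<in>I. A k i * x i) = 0" for x using True by simp
    ultimately show ?thesis by (metis insert_iff)
  next
    case False
    then obtain j where j: "j \<in> I" "A k j \<noteq> 0" by blast
    \<comment> \<open>Row \<open>l\<close> after subtracting the multiple of row \<open>k\<close>
      that clears column \<open>j\<close>.\<close>
    define B where "B l i = A l i - A l j * A k i / A k j" for l i
    have "card K < card (I - {j})" using insert.prems insert.hyps j by simp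
    then have "\<exists>x. (\<exists>i\<in>I - {j}. x i \<noteq> 0) \<and> (\<forall>l\<in>K. (\<Sum>i\<in>I - {j}. B l i * x i) = 0)"
      using \<open>finite I\<close> by (intro insert.IH) auto
    then obtain x where x: "\<exists>i\<in>I - {j}. x i \<noteq> 0" "\<And>l. l \<in> K \<Longrightarrow> (\<Sum>i\<in>I - {j}. B l i * x i) = 0"
      by blast
    define S where "S = (\<Sum>i\<in>I - {j}. A k i * x i)"
    \<comment> \<open>The pivot unknown is set so that row \<open>k\<close> holds; substituting it
      into another row \<open>l\<close> leaves exactly the reduced row \<open>B l\<close>.\<close>
    define y where "y = x(j := - S / A k j)"
    have sum_y: "(\<Sum>i\<in>I. A l i * y i) = (\<Sum>i\<in>I - {j}. A l i * x i) - A l j * S / A k j" for l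
    proof -
      have "(\<Sum>i\<in>I. A l i * y i) = A l j * y j + (\<Sum>i\<in>I - {j}. A l i * y i)"
        by (rule sum.remove[OF \<open>finite I\<close> j(1)])
      also have "(\<Sum>i\<in>I - {j}. A l i * y i) = (\<Sum>i\<in>I - {j}. A l i * x i)"
        by (rule sum.cong) (auto simp: y_def)
      finally show ?thesis by (simp add: y_def)
    qed
    have "(\<Sum>i\<in>I. A l i * y i) = 0" if "l \<in> insert k K" for l
    proof (cases "l = k")
      case True
      then show ?thesis using sum_y[of k] j by (simp add: S_def)
    next
      case False
      then have "(\<Sum>i\<in>I - {j}. B l i * x i) = 0" using x that by blast
      moreover have "(\<Sum>i\<in>I - {j}. B l i * x i) = (\<Sum>i\<in>I - {j}. A l i * x i) - A l j * S / A k j"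
        by (simp add: B_def S_def left_diff_distrib sum_subtractf sum_distrib_left sum_divide_distrib mult.assoc)
      ultimately show ?thesis using sum_y by simp
    qed
    moreover have "\<exists>i\<in>I. y i \<noteq> 0" using x by (auto simp: y_def)
    ultimately show ?thesis by blast
  qed
qed

text \<open>Homogenization: the right-hand side becomes the column of an extra unknown
  \<open>None\<close>, so that there are more unknowns than equations. In a nonzero solution the
  value at \<open>None\<close> cannot vanish, by injectivity, and dividing by it solves the original
  system.\<close>

lemma injective_system_surjective:
  fixes A :: "'k \<Rightarrow> 'i \<Rightarrow> 'a::field"
  assumes fin: "finite K" "finite I" and card: "card K \<le> card I"
    and inj: "\<And>x. (\<And>k. k \<in> K \<Longrightarrow> (\<Sum>i\<in>I. A k i * x i) = 0) \<Longrightarrow> \<forall>i\<in>I. x i = 0"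
  shows "\<exists>x. \<forall>k\<in>K. (\<Sum>i\<in>I. A k i * x i) = y k"
proof -
  define J where "J = insert None (Some ` I)"
  define B where "B k = (\<lambda>i. case i of None \<Rightarrow> - y k | Some i \<Rightarrow> A k i)" for k
  have sum_J: "(\<Sum>i\<in>J. B k i * x i) = (\<Sum>i\<in>I. A k i * x (Some i)) - y k * x None" for k x
    using fin by (simp add: J_def B_def sum.reindex)
  have "card J = Suc (card I)" using fin by (simp add: J_def card_image)
  then have "\<exists>x. (\<exists>i\<in>J. x i \<noteq> 0) \<and> (\<forall>k\<in>K. (\<Sum>i\<in>J. B k i * x i) = 0)"
    using fin card by (intro underdetermined_system) (auto simp: J_def)
  then obtain x where x: "\<exists>i\<in>J. x i \<noteq> 0" "\<And>k. k \<in> K \<Longrightarrow> (\<Sum>i\<in>I. A k i * x (Some i)) = y k * x None"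
    unfolding sum_J by auto
  have "x None \<noteq> 0"
  proof
    assume "x None = 0"
    then have "\<forall>i\<in>I. x (Some i) = 0" using x(2) by (intro inj) simp
    then show False using x(1) \<open>x None = 0\<close> by (auto simp: J_def)
  qed
  have "(\<Sum>i\<in>I. A k i * (x (Some i) / x None)) = y k" if "k \<in> K" for k
  proof -
    have "(\<Sum>i\<in>I. A k i * (x (Some i) / x None)) = (\<Sum>i\<in>I. A k i * x (Some i)) / x None"
      by (simp add: sum_divide_distrib)
    then show ?thesis using x(2)[OF that] \<open>x None \<noteq> 0\<close> by simp
  qed
  then show ?thesis by (intro exI[of _ "\<lambda>i. x (Some i) / x None"] ballI)
qed

text \<open>Supplies the matrix of a functional in the unit vectors. The index type may be infinite,
  hence the truncation of the argument to the finite set \<open>I\<close>.\<close>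

lemma linear_functional_eq_sum:
  fixes \<phi> :: "('i \<Rightarrow> 'a::comm_ring_1) \<Rightarrow> 'a"
  assumes add: "\<And>x y. \<phi> (\<lambda>i. x i + y i) = \<phi> x + \<phi> y" and scale: "\<And>c x. \<phi> (\<lambda>i. c * x i) = c * \<phi> x"
    and "finite I"
  shows "\<phi> (\<lambda>i. if i \<in> I then x i else 0) = (\<Sum>i\<in>I. \<phi> (\<lambda>j. of_bool (j = i)) * x i)"
  using \<open>finite I\<close>
proof induction
  case empty
  show ?case using scale[of 0 "\<lambda>_. 0"] by simp
next
  case (insert k I)
  have "(\<lambda>i. if i \<in> insert k I then x i else 0) = (\<lambda>i. x k * of_bool (i = k) + (if i \<in> I then x i else 0))"
    using insert by auto
  then have "\<phi> (\<lambda>i. if i \<in> insert k I then x i else 0) =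
      x k * \<phi> (\<lambda>i. of_bool (i = k)) + \<phi> (\<lambda>i. if i \<in> I then x i else 0)"
    by (simp only: add scale)
  then show ?case using insert by (simp add: mult.commute)
qed

text \<open>A matrix-free form of the previous result, so that the constraints can be written with
  vectors and inner products. Every argument is truncated to \<open>I\<close>, where the functionals
  have matrices.\<close>

lemma injective_functionals_surjective:
  fixes \<phi> :: "'k \<Rightarrow> ('i \<Rightarrow> 'a::field) \<Rightarrow> 'a"
  assumes fin: "finite K" "finite I" and card: "card K \<le> card I"
    and add: "\<And>k x y. \<phi> k (\<lambda>i. x i + y i) = \<phi> k x + \<phi> k y"
    and scale: "\<And>k c x. \<phi> k (\<lambda>i. c * x i) = c * \<phi> k x"
    and inj: "\<And>x. (\<And>k. k \<in> K \<Longrightarrow> \<phi> k x = 0) \<Longrightarrow> \<forall>i\<in>I. x i = 0"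
  shows "\<exists>x. \<forall>k\<in>K. \<phi> k x = y k"
proof -
  define A where "A k i = \<phi> k (\<lambda>j. of_bool (j = i))" for k i
  have A: "\<phi> k (\<lambda>i. if i \<in> I then x i else 0) = (\<Sum>i\<in>I. A k i * x i)" for k x
    unfolding A_def using add scale fin(2) by (rule linear_functional_eq_sum)
  have "\<exists>x. \<forall>k\<in>K. (\<Sum>i\<in>I. A k i * x i) = y k"
    using fin card
  proof (rule injective_system_surjective)
    fix x assume "\<And>k. k \<in> K \<Longrightarrow> (\<Sum>i\<in>I. A k i * x i) = 0"
    then have "\<forall>i\<in>I. (if i \<in> I then x i else 0) = 0" using A by (intro inj) simp
    then show "\<forall>i\<in>I. x i = 0" by simp
  qed
  then show ?thesis unfolding A[symmetric] by blast
qed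

section \<open>Quadratic perturbations of the identity\<close>

text \<open>Fixed-point iteration for \<open>u = y - Q u\<close>. In the sup norm a quadratic form
  is Lipschitz with constant proportional to the radius of the box, so it is a contraction on a
  small box, and a small \<open>y\<close> keeps all iterates inside this box.\<close>

lemma quadratic_perturbation_solvable:
  fixes c :: "'k \<Rightarrow> 'k \<Rightarrow> 'k \<Rightarrow> real"
  assumes "finite K" "\<epsilon> > 0"
  shows "\<exists>\<delta>>0. \<forall>y. (\<forall>k\<in>K. \<bar>y k\<bar> < \<delta>) \<longrightarrow>
    (\<exists>u. (\<forall>k\<in>K. \<bar>u k\<bar> \<le> \<epsilon> \<and> u k + (\<Sum>i\<in>K. \<Sum>j\<in>K. c k i j * u i * u j) = y k))"
proof -
  define Q where "Q u k = (\<Sum>i\<in>K. \<Sum>j\<in>K. c k i j * u i * u j)" for u :: "'k \<Rightarrow> real" and k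
  \<comment> \<open>The summand 1 keeps \<open>M\<close> positive when all coefficients
    vanish.\<close>
  define M where "M = (\<Sum>k\<in>K. \<Sum>i\<in>K. \<Sum>j\<in>K. \<bar>c k i j\<bar>) + 1"
  have M: "M > 0" unfolding M_def by (intro add_nonneg_pos sum_nonneg) auto
  have cM: "(\<Sum>i\<in>K. \<Sum>j\<in>K. \<bar>c k i j\<bar>) \<le> M" if "k \<in> K" for k
  proof -
    have "(\<Sum>i\<in>K. \<Sum>j\<in>K. \<bar>c k i j\<bar>) \<le> (\<Sum>k\<in>K. \<Sum>i\<in>K. \<Sum>j\<in>K. \<bar>c k i j\<bar>)"
      using that assms by (intro member_le_sum[where f = "\<lambda>k. \<Sum>i\<in>K. \<Sum>j\<in>K. \<bar>c k i j\<bar>"] sum_nonneg) auto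
    then show ?thesis by (simp add: M_def)
  qed
  \<comment> \<open>On the box of radius \<open>r\<close> the Lipschitz constant is at most
    \<open>2 * M * r\<close>, which this choice bounds by 1/2.\<close>
  define r where "r = min \<epsilon> (1 / (4 * M))"
  have r: "r > 0" "r \<le> \<epsilon>" "M * r \<le> 1/4"
    using M assms by (auto simp: r_def min_def field_simps)
  have Qdiff: "\<bar>Q u k - Q w k\<bar> \<le> d / 2"
    if "k \<in> K" "\<And>i. i \<in> K \<Longrightarrow> \<bar>u i\<bar> \<le> r" "\<And>i. i \<in> K \<Longrightarrow> \<bar>w i\<bar> \<le> r"
      "\<And>i. i \<in> K \<Longrightarrow> \<bar>u i - w i\<bar> \<le> d" "d \<ge> 0" for u w k d
  proof -
    have "\<bar>c k i j * u i * u j - c k i j * w i * w j\<bar> \<le> \<bar>c k i j\<bar> * (2 * r * d)" if "i \<in> K" "j \<in> K" for i j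
    proof -
      \<comment> \<open>The usual splitting of a difference of products; each summand has one factor
        bounded by \<open>r\<close> and one by \<open>d\<close>.\<close>
      have "\<bar>u i * u j - w i * w j\<bar> = \<bar>u i * (u j - w j) + (u i - w i) * w j\<bar>" by (simp add: algebra_simps)
      also have "\<dots> \<le> \<bar>u i\<bar> * \<bar>u j - w j\<bar> + \<bar>u i - w i\<bar> * \<bar>w j\<bar>"
        by (metis abs_mult abs_triangle_ineq)
      also have "\<dots> \<le> r * d + d * r"
        using \<open>\<And>i. i \<in> K \<Longrightarrow> \<bar>u i\<bar> \<le> r\<close> \<open>\<And>i. i \<in> K \<Longrightarrow> \<bar>w i\<bar> \<le> r\<close> \<open>\<And>i. i \<in> K \<Longrightarrow> \<bar>u i - w i\<bar> \<le> d\<close> that r \<open>d \<ge> 0\<close>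
        by (intro add_mono mult_mono) auto
      finally have "\<bar>u i * u j - w i * w j\<bar> \<le> 2 * r * d" by (simp add: mult.commute mult.left_commute)
      moreover have "c k i j * u i * u j - c k i j * w i * w j = c k i j * (u i * u j - w i * w j)"
        by (simp add: right_diff_distrib mult.assoc)
      ultimately show ?thesis by (metis abs_mult abs_ge_zero mult_left_mono)
    qed note term_le = this
    have "\<bar>Q u k - Q w k\<bar> = \<bar>\<Sum>i\<in>K. \<Sum>j\<in>K. c k i j * u i * u j - c k i j * w i * w j\<bar>"
      by (simp add: Q_def sum_subtractf)
    also have "\<dots> \<le> (\<Sum>i\<in>K. \<bar>\<Sum>j\<in>K. c k i j * u i * u j - c k i j * w i * w j\<bar>)" by (rule sum_abs)
    also have "\<dots> \<le> (\<Sum>i\<in>K. \<Sum>j\<in>K. \<bar>c k i j\<bar> * (2 * r * d))"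
      by (intro sum_mono order.trans[OF sum_abs] term_le)
    also have "\<dots> = (\<Sum>i\<in>K. \<Sum>j\<in>K. \<bar>c k i j\<bar>) * (2 * r * d)" by (simp add: sum_distrib_right)
    also have "\<dots> \<le> M * (2 * r * d)" using cM[OF \<open>k \<in> K\<close>] r \<open>d \<ge> 0\<close> by (intro mult_right_mono) auto
    also have "\<dots> = (M * r) * (2 * d)" by simp
    also have "\<dots> \<le> (1/4) * (2 * d)" using r \<open>d \<ge> 0\<close> by (intro mult_right_mono) auto
    finally show ?thesis by simp
  qed
  have "\<exists>u. \<forall>k\<in>K. \<bar>u k\<bar> \<le> \<epsilon> \<and> u k + Q u k = y k" if y: "\<forall>k\<in>K. \<bar>y k\<bar> < r / 2" for y
  proof -
    \<comment> \<open>The Picard iterates, started at 0.\<close>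
    define s where "s n = ((\<lambda>u k. y k - Q u k) ^^ n) (\<lambda>_. 0)" for n
    have s0: "s 0 = (\<lambda>_. 0)" and sS: "s (Suc n) k = y k - Q (s n) k" for n k by (simp_all add: s_def)
    have s_le: "\<bar>s n k\<bar> \<le> r" if "k \<in> K" for n k
      using that
    proof (induction n arbitrary: k)
      case (Suc n)
      have "\<bar>Q (s n) k - Q (\<lambda>_. 0) k\<bar> \<le> r / 2" using Suc r by (intro Qdiff) auto
      then have "\<bar>Q (s n) k\<bar> \<le> r / 2" by (simp add: Q_def)
      moreover have "\<bar>y k\<bar> < r/2" using y Suc by blast
      ultimately show ?case unfolding sS by linarith
    qed (use r s0 in auto)
    have s_diff: "\<bar>s (Suc n) k - s n k\<bar> \<le> r * (1/2) ^ n" if "k \<in> K" for n k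
      using that
    proof (induction n arbitrary: k)
      case 0
      then show ?case using s_le[of k 1] by (simp add: s0)
    next
      case (Suc n)
      have "\<bar>Q (s (Suc n)) k - Q (s n) k\<bar> \<le> r * (1/2)^n / 2"
        using Suc s_le r by (intro Qdiff) auto
      moreover have "s (Suc (Suc n)) k - s (Suc n) k = Q (s n) k - Q (s (Suc n)) k"
        using sS[of "Suc n" k] sS[of n k] by linarith
      ultimately show ?case by (simp add: abs_minus_commute)
    qed
    have "convergent (\<lambda>n. s n k)" if "k \<in> K" for k
    proof -
      \<comment> \<open>The increments are dominated by a geometric series, and their partial sums
        telescope to the iterates.\<close>
      have "summable (\<lambda>n. s (Suc n) k - s n k)"
        by (rule summable_comparison_test'[where g = "\<lambda>n. r * (1/2)^n" and N = 0])
          (use s_diff[OF that] in \<open>auto intro!: summable_mult\<close>)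
      then have "convergent (\<lambda>n. \<Sum>i<n. s (Suc i) k - s i k)" by (simp add: summable_iff_convergent)
      moreover have "(\<Sum>i<n. s (Suc i) k - s i k) = s n k" for n
        by (induction n) (simp_all add: s0)
      ultimately show ?thesis by simp
    qed
    moreover define u where "u k = lim (\<lambda>n. s n k)" for k
    ultimately have u: "(\<lambda>n. s n k) \<longlonglongrightarrow> u k" if "k \<in> K" for k
      using that by (simp add: convergent_LIMSEQ_iff)
    have "\<bar>u k\<bar> \<le> \<epsilon> \<and> u k + Q u k = y k" if "k \<in> K" for k
    proof
      have "\<bar>u k\<bar> \<le> r" by (rule LIMSEQ_le_const2[OF tendsto_rabs[OF u[OF that]]]) (use s_le that in auto)
      then show "\<bar>u k\<bar> \<le> \<epsilon>" using r by linarith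
      have "(\<lambda>n. y k - Q (s n) k) \<longlonglongrightarrow> y k - Q u k" unfolding Q_def by (intro tendsto_intros u)
      then have "(\<lambda>n. s (Suc n) k) \<longlonglongrightarrow> y k - Q u k" by (simp add: sS)
      then have "u k = y k - Q u k" using LIMSEQ_Suc[OF u[OF that]] LIMSEQ_unique by blast
      then show "u k + Q u k = y k" by simp
    qed
    then show ?thesis by blast
  qed
  then show ?thesis using r unfolding Q_def by (intro exI[of _ "r/2"]) auto
qed

section \<open>Counting faces of 3-polytopes\<close>

text \<open>The signs of \<open>n1\<close> and \<open>n2\<close> make \<open>w1\<close> and
  \<open>w2\<close> a basis of the plane orthogonal to \<open>a\<close>. On a combination of them,
  \<open>n1\<close> sees only the coefficient of \<open>w2\<close> and \<open>n2\<close> only that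
  of \<open>w1\<close>, so the two inequalities force both coefficients to be nonnegative.\<close>

lemma planar_cone:
  fixes a w w1 w2 n1 n2 :: "real^3"
  assumes "a \<noteq> 0" "a \<bullet> w1 = 0" "a \<bullet> w2 = 0" "a \<bullet> w = 0"
    and n: "n1 \<bullet> w1 = 0" "n1 \<bullet> w2 < 0" "n2 \<bullet> w2 = 0" "n2 \<bullet> w1 < 0"
    and le: "n1 \<bullet> w \<le> 0" "n2 \<bullet> w \<le> 0"
  obtains c1 c2 where "c1 \<ge> 0" "c2 \<ge> 0" "w = c1 *\<^sub>R w1 + c2 *\<^sub>R w2"
proof -
  have w12: "w1 \<noteq> c *\<^sub>R w2" for c using n by auto
  have ind: "independent {w1, w2}"
    using n w12 by (auto simp: independent_insert span_singleton)
  have "{x. a \<bullet> x = 0} \<subseteq> span {w1, w2}"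
  proof (rule card_ge_dim_independent)
    have "card {w1, w2} = 2" using w12[of 1] by simp
    then show "dim {x. a \<bullet> x = 0} \<le> card {w1, w2}" using assms(1) by (simp add: dim_hyperplane)
  qed (use assms ind in auto)
  then have "w \<in> span {w1, w2}" using assms by blast
  then obtain c1 c2 where c: "w = c1 *\<^sub>R w1 + c2 *\<^sub>R w2"
    by (auto simp: span_insert span_singleton algebra_simps)
  have "c2 \<ge> 0" "c1 \<ge> 0" using le n unfolding c by (auto simp: inner_add_right mult_le_0_iff)
  then show ?thesis using c that by blast
qed

text \<open>Applied below to the edges of a facet at a vertex, to the facets at an edge, and to the facets at a
  vertex met by a level plane: \<open>w i\<close> is a direction into the \<open>i\<close>-th face, and \<open>n i\<close> supports that face.\<close>

lemma card_planar_le_2: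
  fixes a :: "real^3"
  assumes "a \<noteq> 0" "\<And>i. i \<in> S \<Longrightarrow> a \<bullet> w i = 0" "\<And>i. i \<in> S \<Longrightarrow> n i \<bullet> w i = 0"
    and "\<And>i j. i \<in> S \<Longrightarrow> j \<in> S \<Longrightarrow> i \<noteq> j \<Longrightarrow> n i \<bullet> w j < 0"
  shows "card S \<le> 2"
proof (rule ccontr)
  assume "\<not> card S \<le> 2"
  then have "3 \<le> card S" by simp
  then obtain T where "T \<subseteq> S" "card T = 3" by (meson obtain_subset_with_card_n)
  then obtain i j k where ijk: "i \<in> S" "j \<in> S" "k \<in> S" "i \<noteq> j" "j \<noteq> k" "i \<noteq> k"
    by (auto simp: card_3_iff)
  have neg: "n i \<bullet> w j < 0" "n j \<bullet> w i < 0" "n i \<bullet> w k < 0" "n j \<bullet> w k < 0" "n k \<bullet> w i < 0" "n k \<bullet> w j < 0"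
    using assms(4) ijk by metis+
  \<comment> \<open>Among three such directions, the third lies in the cone of the other two. Its
    own functional is negative on both generators but zero on it, so it would have to be the zero
    vector.\<close>
  obtain c1 c2 where c: "c1 \<ge> 0" "c2 \<ge> 0" "w k = c1 *\<^sub>R w i + c2 *\<^sub>R w j"
    by (rule planar_cone[of a "w i" "w j" "w k" "n i" "n j"])
      (use assms(1-3) ijk neg in \<open>auto intro: less_imp_le\<close>)
  have "n k \<bullet> w k = c1 * (n k \<bullet> w i) + c2 * (n k \<bullet> w j)"
    unfolding c(3) by (simp add: inner_add_right)
  moreover have "c1 * (n k \<bullet> w i) \<le> 0" "c2 * (n k \<bullet> w j) \<le> 0" using c neg by (simp_all add: mult_le_0_iff)
  ultimately have "c1 * (n k \<bullet> w i) = 0" "c2 * (n k \<bullet> w j) = 0" using assms(3)[OF ijk(3)] by linarith+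
  then have "w k = 0" using neg c(3) by simp
  then show False using neg by simp
qed

text \<open>A proper face of a polyhedron is the intersection of the facets containing it. With a
  single facet the face would have codimension 1.\<close>

lemma two_le_card_facets_through_face:
  assumes "polyhedron S" "C face_of S" "C \<noteq> {}" "aff_dim C + 2 \<le> aff_dim S"
  shows "2 \<le> card {F. F facet_of S \<and> C \<subseteq> F}"
proof (rule ccontr)
  let ?X = "{F. F facet_of S \<and> C \<subseteq> F}"
  assume "\<not> 2 \<le> card ?X"
  moreover have fin: "finite ?X"
    by (rule finite_subset[OF _ finite_polyhedron_facets[OF assms(1)]]) auto
  moreover have C: "C = \<Inter> ?X" using assms by (intro face_of_polyhedron) auto
  \<comment> \<open>The empty intersection is the whole space, which would give
    \<open>C = S\<close>.\<close>
  moreover have "?X \<noteq> {}"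
  proof
    assume "?X = {}"
    with C have "C = \<Inter> {}" by (rule trans[OF _ arg_cong[of _ _ Inter]])
    then have "S = C" using face_of_imp_subset[OF assms(2)] by auto
    then show False using assms(4) by simp
  qed
  ultimately have "card ?X = 1" by (metis One_nat_def card_0_eq less_2_cases not_le)
  then obtain F where F: "?X = {F}" by (auto simp: card_1_singleton_iff)
  with C have "C = \<Inter> {F}" by (rule trans[OF _ arg_cong[of _ _ Inter]])
  then have "C = F" by simp
  then have "aff_dim C = aff_dim S - 1" using F by (auto simp: facet_of_def)
  then show False using assms by simp
qed

text \<open>The unsuitable \<open>h\<close> lie on finitely many hyperplanes, one for each pair of
  distinct points, and these form a null set.\<close>

lemma finite_separating_functional:
  fixes V :: "'a::euclidean_space set"
  assumes "finite V"
  obtains h where "inj_on (\<lambda>v. h \<bullet> v) V"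
proof -
  let ?N = "\<Union>(u, v)\<in>{(u, v). u \<in> V \<and> v \<in> V \<and> u \<noteq> v}. {x. (u - v) \<bullet> x = 0}"
  have "finite {(u, v). u \<in> V \<and> v \<in> V \<and> u \<noteq> v}"
    by (rule finite_subset[of _ "V \<times> V"]) (use assms in auto)
  then have "negligible ?N"
    by (intro negligible_Union finite_imageI) (auto intro!: negligible_hyperplane)
  then have "?N \<noteq> UNIV" by (metis non_negligible_UNIV)
  then obtain h where "h \<notin> ?N" by blast
  then have "inj_on (\<lambda>v. h \<bullet> v) V"
    by (auto simp: inj_on_def inner_diff_left inner_commute[of h])
  then show ?thesis by (rule that)
qed

text \<open>A one-dimensional face is compact, convex and collinear, hence a segment, and the
  extreme points of a face are extreme in \<open>P\<close>.\<close>

lemma edge_of_polytope_segment: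
  assumes "polytope P" "e edge_of P"
  obtains u v where "u \<noteq> v" "e = closed_segment u v" "u extreme_point_of P" "v extreme_point_of P"
proof -
  have e: "e face_of P" "aff_dim e = 1" using assms by (auto simp: edge_of_def)
  then have "polytope e" using assms face_of_polytope_polytope by blast
  moreover have "e \<noteq> {}" using e by auto
  moreover have "collinear e" using e by (simp add: collinear_aff_dim)
  ultimately obtain u v where uv: "e = closed_segment u v"
    by (metis compact_convex_collinear_segment polytope_imp_compact polytope_imp_convex)
  have "u \<noteq> v" using e uv by auto
  moreover have "u extreme_point_of P" "v extreme_point_of P"
    using extreme_point_of_face[OF e(1)] extreme_point_of_segment uv by blast+
  ultimately show ?thesis using that uv by blast
qed

lemma edge_of_polytope_at_vertex:
  assumes "polytope P" "e edge_of P" "v extreme_point_of P" "v \<in> e"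
  obtains u where "u \<noteq> v" "e = closed_segment v u" "u extreme_point_of P"
proof -
  obtain a b where ab: "a \<noteq> b" "e = closed_segment a b" "a extreme_point_of P" "b extreme_point_of P"
    using edge_of_polytope_segment[OF assms(1,2)] .
  have "v extreme_point_of e" using assms extreme_point_of_face unfolding edge_of_def by blast
  then have "v = a \<or> v = b" using ab by (simp add: extreme_point_of_segment)
  then show ?thesis using ab that[of a] that[of b] by (auto simp: closed_segment_commute)
qed

lemma edge_of_subset_eq:
  assumes "e edge_of P" "e' edge_of P" "e' \<subseteq> e"
  shows "e' = e"
proof (rule ccontr)
  assume "e' \<noteq> e"
  moreover have "e' face_of e"
    using assms face_of_subset[of e' P e] face_of_imp_subset by (auto simp: edge_of_def)
  ultimately have "aff_dim e' < aff_dim e"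
    using assms by (intro face_of_aff_dim_lt) (auto simp: edge_of_def face_of_imp_convex)
  then show False using assms by (simp add: edge_of_def)
qed

section \<open>Incidences of vertices, edges and facets\<close>

locale polytope3 =
  fixes P :: "(real^3) set"
  assumes poly: "polytope P" and dim_P: "aff_dim P = 3" and int_P: "0 \<in> interior P"
begin

abbreviation "V \<equiv> {v. v extreme_point_of P}"
abbreviation "Es \<equiv> {e. e edge_of P}"
abbreviation "Fs \<equiv> {\<sigma>. \<sigma> facet_of P}"
abbreviation "N \<equiv> facet_normal P"

lemmas polyhedron_P = polytope_imp_polyhedron[OF poly]
lemmas convex_P = polytope_imp_convex[OF poly]
lemmas compact_P = polytope_imp_compact[OF poly]

lemma finite_V: "finite V" and finite_Fs: "finite Fs" and finite_Es: "finite Es"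
proof -
  show "finite V" "finite Fs"
    by (simp_all add: finite_polyhedron_extreme_points finite_polyhedron_facets polyhedron_P)
  show "finite Es"
    by (rule finite_subset[OF _ finite_polytope_faces[OF poly]]) (auto simp: edge_of_def)
qed

lemma P_eq_hull: "P = convex hull V"
  by (rule Krein_Milman_Minkowski) (simp_all add: compact_P convex_P)

lemma facet:
  assumes "\<sigma> facet_of P"
  shows "\<sigma> face_of P" "aff_dim \<sigma> = 2" "\<sigma> \<subseteq> P" "polytope \<sigma>" "convex \<sigma>"
    and "\<And>x. x \<in> P \<Longrightarrow> N \<sigma> \<bullet> x \<le> 1" "\<And>x. x \<in> P \<Longrightarrow> x \<in> \<sigma> \<longleftrightarrow> N \<sigma> \<bullet> x = 1"
proof -
  show face: "\<sigma> face_of P" and "aff_dim \<sigma> = 2" using assms dim_P by (auto simp: facet_of_def)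
  show "\<sigma> \<subseteq> P" "polytope \<sigma>" "convex \<sigma>"
    using face_of_imp_subset[OF face] face_of_polytope_polytope[OF poly face] face_of_imp_convex[OF face] .
  show "N \<sigma> \<bullet> x \<le> 1" if "x \<in> P" for x using facet_normal(1)[OF poly dim_P int_P assms] that by blast
  show "x \<in> \<sigma> \<longleftrightarrow> N \<sigma> \<bullet> x = 1" if "x \<in> P" for x
    using facet_normal(2)[OF poly dim_P int_P assms] that by blast
qed

lemma vertex_in_P: "v \<in> V \<Longrightarrow> v \<in> P"
  by (simp add: extreme_point_of_def)

lemma facet_normal_neg:
  assumes "\<sigma> facet_of P" "x \<in> P" "x \<notin> \<sigma>"
  shows "N \<sigma> \<bullet> x < 1"
  using facet[OF assms(1)] assms by (metis less_le)

text \<open>The intersection is a proper face of at least one of the two distinct facets, and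
  passing to a proper face lowers the dimension.\<close>

lemma facet_Int_aff_dim:
  assumes "\<sigma> facet_of P" "\<tau> facet_of P" "\<sigma> \<noteq> \<tau>"
  shows "\<sigma> \<inter> \<tau> face_of P" "aff_dim (\<sigma> \<inter> \<tau>) \<le> 1"
proof -
  show face: "\<sigma> \<inter> \<tau> face_of P" using facet assms by (simp add: face_of_Int)
  have lt: "aff_dim C < 2" if "C face_of \<rho>" "C \<noteq> \<rho>" "\<rho> facet_of P" for C \<rho>
    using face_of_aff_dim_lt[OF facet(5)[OF that(3)] that(1,2)] facet(2)[OF that(3)] by simp
  have sub: "\<sigma> \<subseteq> P" "\<tau> \<subseteq> P" using assms facet(3) by auto
  show "aff_dim (\<sigma> \<inter> \<tau>) \<le> 1"
  proof (cases "\<sigma> \<inter> \<tau> = \<sigma>")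
    case True
    then have "\<sigma> \<inter> \<tau> \<noteq> \<tau>" using assms(3) by auto
    moreover have "\<sigma> \<inter> \<tau> face_of \<tau>" by (rule face_of_subset[OF face _ sub(2)]) simp
    ultimately show ?thesis using lt[OF _ _ assms(2)] by force
  next
    case False
    moreover have "\<sigma> \<inter> \<tau> face_of \<sigma>" by (rule face_of_subset[OF face _ sub(1)]) simp
    ultimately show ?thesis using lt[OF _ _ assms(1)] by force
  qed
qed

text \<open>Project along the edge and apply \<open>card_planar_le_2\<close> in the plane orthogonal
  to it. The direction of a facet is given by one of its points off the edge. Such a point lies in
  no other facet through the edge, because two facets through \<open>e\<close> meet exactly in
  \<open>e\<close>.\<close>

lemma card_facets_through_edge_le_2:
  assumes "e edge_of P"
  shows "card {\<sigma> \<in> Fs. e \<subseteq> \<sigma>} \<le> 2"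
proof -
  obtain s t where st: "s \<noteq> t" "e = closed_segment s t" using edge_of_polytope_segment[OF poly assms] by metis
  define d where "d = t - s"
  have d: "d \<noteq> 0" using st by (simp add: d_def)
  have st_e: "s \<in> e" "t \<in> e" using st by auto
  have "\<exists>q. q \<in> \<sigma> \<and> q \<notin> e" if "\<sigma> \<in> Fs" for \<sigma>
  proof (rule ccontr)
    assume "\<not> ?thesis"
    then have "aff_dim \<sigma> \<le> aff_dim e" by (intro aff_dim_subset) auto
    then show False using facet(2)[of \<sigma>] that assms by (simp add: edge_of_def)
  qed
  then obtain q where q: "\<And>\<sigma>. \<sigma> \<in> Fs \<Longrightarrow> q \<sigma> \<in> \<sigma> \<and> q \<sigma> \<notin> e" by metis
  \<comment> \<open>The component of \<open>q \<sigma> - s\<close> orthogonal to the edge. The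
    normal of a facet through \<open>e\<close> is constant along \<open>e\<close>, so removing the
    other component does not change its value.\<close>
  define w where "w \<sigma> = (q \<sigma> - s) - ((q \<sigma> - s) \<bullet> d / (d \<bullet> d)) *\<^sub>R d" for \<sigma>
  have N_w: "N \<sigma> \<bullet> w \<tau> = N \<sigma> \<bullet> q \<tau> - 1" if "\<sigma> \<in> Fs" "e \<subseteq> \<sigma>" for \<sigma> \<tau>
  proof -
    have "s \<in> \<sigma>" "t \<in> \<sigma>" "\<sigma> \<subseteq> P" using that st_e facet(3)[of \<sigma>] by auto
    then have "N \<sigma> \<bullet> s = 1" "N \<sigma> \<bullet> t = 1" using facet(7)[of \<sigma>] that by auto
    then show ?thesis by (simp add: w_def d_def inner_diff_right)
  qed
  show ?thesis
  proof (rule card_planar_le_2[OF d, where w = w and n = N])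
    show "d \<bullet> w \<sigma> = 0" for \<sigma> using d by (simp add: w_def inner_diff_right inner_commute)
    show "N \<sigma> \<bullet> w \<sigma> = 0" if "\<sigma> \<in> {\<sigma> \<in> Fs. e \<subseteq> \<sigma>}" for \<sigma>
    proof -
      have "q \<sigma> \<in> \<sigma>" "q \<sigma> \<in> P" using q[of \<sigma>] facet(3)[of \<sigma>] that by auto
      then show ?thesis using that N_w[of \<sigma> \<sigma>] facet(7)[of \<sigma>] by auto
    qed
    show "N \<sigma> \<bullet> w \<tau> < 0" if st: "\<sigma> \<in> {\<sigma> \<in> Fs. e \<subseteq> \<sigma>}" "\<tau> \<in> {\<sigma> \<in> Fs. e \<subseteq> \<sigma>}" "\<sigma> \<noteq> \<tau>" for \<sigma> \<tau>
    proof -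
      have I: "\<sigma> \<inter> \<tau> face_of P" "aff_dim (\<sigma> \<inter> \<tau>) \<le> 1" using facet_Int_aff_dim[of \<sigma> \<tau>] st by auto
      moreover have "1 \<le> aff_dim (\<sigma> \<inter> \<tau>)"
        using aff_dim_subset[of e "\<sigma> \<inter> \<tau>"] st assms by (simp add: edge_of_def)
      \<comment> \<open>The intersection has dimension exactly 1, so it is an edge containing
        \<open>e\<close>, hence \<open>e\<close> itself.\<close>
      ultimately have "\<sigma> \<inter> \<tau> edge_of P" by (simp add: edge_of_def)
      then have "e = \<sigma> \<inter> \<tau>" using edge_of_subset_eq[of "\<sigma> \<inter> \<tau>" P e] assms st by simp
      then have "q \<tau> \<notin> \<sigma>" "q \<tau> \<in> P" using q[of \<tau>] st facet(3)[of \<tau>] by auto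
      then show ?thesis using facet_normal_neg[of \<sigma> "q \<tau>"] N_w[of \<sigma> \<tau>] st by auto
    qed
  qed
qed

lemma two_le_card_facets_through_edge:
  assumes "e edge_of P"
  shows "2 \<le> card {\<sigma> \<in> Fs. e \<subseteq> \<sigma>}"
  using two_le_card_facets_through_face[OF polyhedron_P, of e] assms dim_P
  by (force simp: edge_of_def)

text \<open>Inside the polygon \<open>\<sigma>\<close> the vertex has codimension 2, and the facets
  of \<open>\<sigma>\<close> are edges of \<open>P\<close>.\<close>

lemma two_le_card_edges_at_vertex:
  assumes "v \<in> V" "\<sigma> facet_of P" "v \<in> \<sigma>"
  shows "2 \<le> card {e \<in> Es. v \<in> e \<and> e \<subseteq> \<sigma>}"
proof -
  have "{v} face_of \<sigma>"
    using assms face_of_subset[of "{v}" P \<sigma>] facet(3)[OF assms(2)] by (simp add: face_of_singleton)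
  then have "2 \<le> card {F. F facet_of \<sigma> \<and> {v} \<subseteq> F}"
    using facet[OF assms(2)] by (intro two_le_card_facets_through_face polytope_imp_polyhedron) auto
  also have "\<dots> \<le> card {e \<in> Es. v \<in> e \<and> e \<subseteq> \<sigma>}"
  proof (rule card_mono)
    show "finite {e \<in> Es. v \<in> e \<and> e \<subseteq> \<sigma>}" using finite_Es by simp
    show "{F. F facet_of \<sigma> \<and> {v} \<subseteq> F} \<subseteq> {e \<in> Es. v \<in> e \<and> e \<subseteq> \<sigma>}"
      using facet(2)[OF assms(2)] face_of_trans[OF _ facet(1)[OF assms(2)]] facet_of_imp_subset[of _ \<sigma>]
      by (auto simp: facet_of_def edge_of_def dest: face_of_imp_subset)
  qed
  finally show ?thesis .
qed

text \<open>Faces of a polyhedron are exposed. The functional plays the role of \<open>n\<close> in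
  the planar lemmas.\<close>

lemma edge_supporting_functional:
  assumes "e edge_of P" "v \<in> e"
  obtains n where "\<And>x. x \<in> P \<Longrightarrow> n \<bullet> (x - v) \<le> 0" "\<And>x. x \<in> P \<Longrightarrow> x \<in> e \<longleftrightarrow> n \<bullet> (x - v) = 0"
proof -
  have "e exposed_face_of P" using assms exposed_face_of_polyhedron[OF polyhedron_P] by (simp add: edge_of_def)
  then obtain n b where nb: "P \<subseteq> {x. n \<bullet> x \<le> b}" "e = P \<inter> {x. n \<bullet> x = b}"
    by (auto simp: exposed_face_of_def)
  then have "n \<bullet> v = b" using assms by blast
  then show ?thesis using nb by (intro that[of n]) (auto simp: inner_diff_right)
qed

text \<open>Otherwise \<open>e'\<close> would be contained in \<open>e\<close>, and nested edges are
  equal. This makes the supporting functional of one edge strictly negative along the other.\<close>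

lemma adjacent_edges:
  assumes "v \<in> V" "\<sigma> facet_of P"
    and e: "e edge_of P" "v \<in> e" "e \<subseteq> \<sigma>" "e = closed_segment v u"
    and e': "e' edge_of P" "v \<in> e'" "e' \<subseteq> \<sigma>" "e' = closed_segment v u'"
    and "e \<noteq> e'"
  shows "u' \<notin> e"
proof
  assume "u' \<in> e"
  then have "e' \<subseteq> e" using e e' by (simp add: subset_closed_segment)
  then show False using edge_of_subset_eq assms by blast
qed

text \<open>\<open>card_planar_le_2\<close> in the plane of the facet: the directions run from
  \<open>v\<close> to the other ends of the edges, and each edge has its own supporting
  functional.\<close>

lemma card_edges_at_vertex_le_2:
  assumes "v \<in> V" "\<sigma> facet_of P"
  shows "card {e \<in> Es. v \<in> e \<and> e \<subseteq> \<sigma>} \<le> 2"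
proof -
  let ?S = "{e \<in> Es. v \<in> e \<and> e \<subseteq> \<sigma>}"
  have "\<exists>u. \<forall>e\<in>?S. e = closed_segment v (u e)"
  proof (intro bchoice ballI)
    fix e assume "e \<in> ?S"
    then obtain u where "e = closed_segment v u"
      using edge_of_polytope_at_vertex[OF poly, of e v] assms(1) by blast
    then show "\<exists>u. e = closed_segment v u" ..
  qed
  then obtain u where u: "\<And>e. e \<in> ?S \<Longrightarrow> e = closed_segment v (u e)" by blast
  have "\<exists>n. \<forall>e\<in>?S. \<forall>x\<in>P. n e \<bullet> (x - v) \<le> 0 \<and> (x \<in> e \<longleftrightarrow> n e \<bullet> (x - v) = 0)"
  proof (intro bchoice ballI)
    fix e assume "e \<in> ?S"
    then obtain n where "\<And>x. x \<in> P \<Longrightarrow> n \<bullet> (x - v) \<le> 0" "\<And>x. x \<in> P \<Longrightarrow> x \<in> e \<longleftrightarrow> n \<bullet> (x - v) = 0"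
      using edge_supporting_functional[of e v] by auto
    then show "\<exists>n. \<forall>x\<in>P. n \<bullet> (x - v) \<le> 0 \<and> (x \<in> e \<longleftrightarrow> n \<bullet> (x - v) = 0)" by blast
  qed
  then obtain n where n: "\<And>e x. e \<in> ?S \<Longrightarrow> x \<in> P \<Longrightarrow> n e \<bullet> (x - v) \<le> 0"
    "\<And>e x. e \<in> ?S \<Longrightarrow> x \<in> P \<Longrightarrow> x \<in> e \<longleftrightarrow> n e \<bullet> (x - v) = 0" by blast
  have u_e: "u e \<in> e" "u e \<in> \<sigma>" "u e \<in> P" "v \<in> \<sigma>" if "e \<in> ?S" for e
    using u[OF that] that facet(3)[OF assms(2)] ends_in_segment(2)[of "u e" v] by auto
  show ?thesis
  proof (cases "?S = {}")
    case True
    then show ?thesis by (simp only: card.empty)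
  next
    case False
    then have "v \<in> \<sigma>" by auto
    show ?thesis
    proof (rule card_planar_le_2[where a = "N \<sigma>" and w = "\<lambda>e. u e - v" and n = n])
      show "N \<sigma> \<noteq> 0" using facet(7)[OF assms(2), of v] \<open>v \<in> \<sigma>\<close> facet(3)[OF assms(2)] by auto
      show "N \<sigma> \<bullet> (u e - v) = 0" if "e \<in> ?S" for e
        using facet(7)[OF assms(2)] u_e[OF that] assms(1) vertex_in_P by (simp add: inner_diff_right)
      show "n e \<bullet> (u e - v) = 0" if "e \<in> ?S" for e using n(2)[OF that] u_e[OF that] by blast
      show "n e \<bullet> (u e' - v) < 0" if ee: "e \<in> ?S" "e' \<in> ?S" "e \<noteq> e'" for e e'
      proof -
        have "u e' \<notin> e" using adjacent_edges[OF assms, of e "u e" e' "u e'"] u ee by auto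
        then show ?thesis using n[of e "u e'"] u_e[OF ee(2)] ee by (simp add: less_le)
      qed
    qed
  qed
qed

text \<open>The polygon lies on one side of each of the two edges, so \<open>planar_cone\<close>
  applies. The use is that a facet with two edges descending from \<open>v\<close> lies entirely at
  or below the level of \<open>v\<close>.\<close>

lemma facet_in_edge_cone:
  assumes "v \<in> V" "\<sigma> facet_of P"
    and e: "e edge_of P" "v \<in> e" "e \<subseteq> \<sigma>" "e = closed_segment v u"
    and e': "e' edge_of P" "v \<in> e'" "e' \<subseteq> \<sigma>" "e' = closed_segment v u'"
    and "e \<noteq> e'" "x \<in> \<sigma>"
  obtains c c' where "c \<ge> 0" "c' \<ge> 0" "x - v = c *\<^sub>R (u - v) + c' *\<^sub>R (u' - v)"
proof -
  obtain n where n: "\<And>x. x \<in> P \<Longrightarrow> n \<bullet> (x - v) \<le> 0" "\<And>x. x \<in> P \<Longrightarrow> x \<in> e \<longleftrightarrow> n \<bullet> (x - v) = 0"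
    using edge_supporting_functional[OF e(1,2)] by blast
  obtain n' where n': "\<And>x. x \<in> P \<Longrightarrow> n' \<bullet> (x - v) \<le> 0" "\<And>x. x \<in> P \<Longrightarrow> x \<in> e' \<longleftrightarrow> n' \<bullet> (x - v) = 0"
    using edge_supporting_functional[OF e'(1,2)] by blast
  have in_\<sigma>: "v \<in> \<sigma>" "u \<in> \<sigma>" "u' \<in> \<sigma>" using e e' by auto
  then have in_P: "v \<in> P" "u \<in> P" "u' \<in> P" "x \<in> P" using facet(3)[OF assms(2)] assms by auto
  have N: "N \<sigma> \<bullet> (y - v) = 0" if "y \<in> \<sigma>" "y \<in> P" for y
    using facet(7)[OF assms(2)] in_\<sigma> in_P that by (simp add: inner_diff_right)
  have "u' \<notin> e" "u \<notin> e'"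
    using adjacent_edges[OF assms(1,2) e e'] adjacent_edges[OF assms(1,2) e' e] assms by auto
  moreover have "u \<in> e" "u' \<in> e'" using e e' by auto
  ultimately have "n \<bullet> (u - v) = 0" "n \<bullet> (u' - v) < 0" "n' \<bullet> (u' - v) = 0" "n' \<bullet> (u - v) < 0"
    using n n' in_P by (metis less_le)+
  moreover have "N \<sigma> \<noteq> 0" using facet(7)[OF assms(2), of v] in_\<sigma> in_P by auto
  ultimately show ?thesis
    using planar_cone[of "N \<sigma>" "u - v" "u' - v" "x - v" n n'] N in_\<sigma> in_P \<open>x \<in> \<sigma>\<close> n(1) n'(1) that by metis
qed

section \<open>Sweeping the polytope by a height function\<close>

abbreviation "down_edges h v \<equiv> {e \<in> Es. v \<in> e \<and> (\<forall>x\<in>e. h \<bullet> x \<le> h \<bullet> v)}"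
abbreviation "topped_facets h v \<equiv> {\<sigma> \<in> Fs. v \<in> \<sigma> \<and> (\<forall>x\<in>\<sigma>. h \<bullet> x \<le> h \<bullet> v)}"
abbreviation "crossed_facets h v \<equiv>
  {\<sigma> \<in> Fs. v \<in> \<sigma> \<and> (\<exists>x\<in>\<sigma>. h \<bullet> x < h \<bullet> v) \<and> (\<exists>y\<in>\<sigma>. h \<bullet> v < h \<bullet> y)}"

text \<open>A segment from below to above the level of \<open>v\<close> crosses this level. The
  crossing point is interior to the segment and therefore differs from the extreme point
  \<open>v\<close>.\<close>

lemma level_segment_in_facet:
  assumes "v \<in> V" "\<sigma> \<in> crossed_facets h v"
  obtains z where "z \<in> \<sigma>" "z \<noteq> v" "h \<bullet> z = h \<bullet> v"
proof -
  obtain x y where xy: "x \<in> \<sigma>" "y \<in> \<sigma>" "h \<bullet> x < h \<bullet> v" "h \<bullet> v < h \<bullet> y" and \<sigma>: "\<sigma> facet_of P"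
    using assms(2) by blast
  define s where "s = (h \<bullet> v - h \<bullet> x) / (h \<bullet> y - h \<bullet> x)"
  define z where "z = (1 - s) *\<^sub>R x + s *\<^sub>R y"
  have s: "0 < s" "s < 1" using xy by (auto simp: s_def)
  have "s * (h \<bullet> y - h \<bullet> x) = h \<bullet> v - h \<bullet> x" using xy by (simp add: s_def)
  then have "h \<bullet> z = h \<bullet> v" by (simp add: z_def inner_add_right algebra_simps)
  moreover have z: "z \<in> open_segment x y"
    using s xy by (auto simp: z_def in_segment)
  moreover have "z \<in> \<sigma>" using z xy facet(5)[OF \<sigma>] closed_segment_subset open_closed_segment by blast
  moreover have "z \<noteq> v" using assms(1) z xy facet(3)[OF \<sigma>] by (auto simp: extreme_point_of_def)
  ultimately show ?thesis using that by blast
qed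

text \<open>\<open>card_planar_le_2\<close> in the level plane through \<open>v\<close>. If the
  level point of one crossed facet lay in another, the two facets would share a horizontal edge at
  \<open>v\<close>, whose other end is a second vertex at the same height.\<close>

lemma card_crossed_facets_le_2:
  assumes inj: "inj_on (\<lambda>v. h \<bullet> v) V" and v: "v \<in> V"
  shows "card (crossed_facets h v) \<le> 2"
proof -
  let ?S = "crossed_facets h v"
  have "\<exists>z. \<forall>\<sigma>\<in>?S. z \<sigma> \<in> \<sigma> \<and> z \<sigma> \<noteq> v \<and> h \<bullet> z \<sigma> = h \<bullet> v"
  proof (intro bchoice ballI)
    fix \<sigma> assume "\<sigma> \<in> ?S"
    from level_segment_in_facet[OF v this] obtain z where "z \<in> \<sigma>" "z \<noteq> v" "h \<bullet> z = h \<bullet> v" .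
    then show "\<exists>z. z \<in> \<sigma> \<and> z \<noteq> v \<and> h \<bullet> z = h \<bullet> v" by blast
  qed
  then obtain z where z: "\<And>\<sigma>. \<sigma> \<in> ?S \<Longrightarrow> z \<sigma> \<in> \<sigma>" "\<And>\<sigma>. \<sigma> \<in> ?S \<Longrightarrow> z \<sigma> \<noteq> v"
    "\<And>\<sigma>. \<sigma> \<in> ?S \<Longrightarrow> h \<bullet> z \<sigma> = h \<bullet> v" by blast
  have S: "\<sigma> facet_of P" "v \<in> \<sigma>" if "\<sigma> \<in> ?S" for \<sigma> using that by simp_all
  have zP: "z \<sigma> \<in> P" if "\<sigma> \<in> ?S" for \<sigma> using z(1)[OF that] facet(3)[OF S(1)[OF that]] by blast
  have vP: "v \<in> P" using v by (rule vertex_in_P)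
  have N_diff: "N \<sigma> \<bullet> (x - v) = N \<sigma> \<bullet> x - 1" if "\<sigma> \<in> ?S" for x \<sigma>
    using facet(7)[OF S(1)[OF that] vP] S(2)[OF that] by (simp add: inner_diff_right)
  show ?thesis
  proof (cases "?S = {}")
    case True
    then show ?thesis by (simp only: card.empty)
  next
    case False
    then have "h \<noteq> 0" by auto
    then show ?thesis
    proof (rule card_planar_le_2[where w = "\<lambda>\<sigma>. z \<sigma> - v" and n = N])
      show "h \<bullet> (z \<sigma> - v) = 0" if "\<sigma> \<in> ?S" for \<sigma> using z(3)[OF that] by (simp add: inner_diff_right)
      show "N \<sigma> \<bullet> (z \<sigma> - v) = 0" if "\<sigma> \<in> ?S" for \<sigma>
        using N_diff[OF that] facet(7)[OF S(1)[OF that] zP[OF that]] z(1)[OF that] by simp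
      show "N \<sigma> \<bullet> (z \<tau> - v) < 0" if st: "\<sigma> \<in> ?S" "\<tau> \<in> ?S" "\<sigma> \<noteq> \<tau>" for \<sigma> \<tau>
      proof -
        have "z \<tau> \<notin> \<sigma>"
        proof
          assume "z \<tau> \<in> \<sigma>"
          then have sub: "{v, z \<tau>} \<subseteq> \<sigma> \<inter> \<tau>" using S st z(1) by blast
          then have "aff_dim {v, z \<tau>} \<le> aff_dim (\<sigma> \<inter> \<tau>)" by (rule aff_dim_subset)
          then have "1 \<le> aff_dim (\<sigma> \<inter> \<tau>)" using z(2)[OF st(2)] by (simp add: aff_dim_2)
          then have edge: "\<sigma> \<inter> \<tau> edge_of P"
            using facet_Int_aff_dim[OF S(1)[OF st(1)] S(1)[OF st(2)] st(3)] by (simp add: edge_of_def)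
          obtain u where u: "u \<noteq> v" "\<sigma> \<inter> \<tau> = closed_segment v u" "u extreme_point_of P"
            by (rule edge_of_polytope_at_vertex[OF poly edge]) (use v sub in auto)
          then obtain t where t: "z \<tau> = (1 - t) *\<^sub>R v + t *\<^sub>R u" using sub by (auto simp: in_segment)
          then have "t \<noteq> 0" using z(2)[OF st(2)] by auto
          moreover have "t * (h \<bullet> u - h \<bullet> v) = 0"
            using z(3)[OF st(2)] unfolding t by (simp add: inner_add_right algebra_simps)
          ultimately have "h \<bullet> u = h \<bullet> v" by simp
          then show False using inj_onD[OF inj, of u v] u v by simp
        qed
        then show ?thesis using facet_normal_neg[OF S(1)[OF st(1)] zP[OF st(2)]] N_diff[OF st(1)] by simp
      qed
    qed
  qed
qed

lemma lower_end_exists: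
  assumes inj: "inj_on (\<lambda>v. h \<bullet> v) V" and "v \<in> V" "e \<in> down_edges h v"
  obtains u where "u \<in> e" "e = closed_segment v u" "h \<bullet> u < h \<bullet> v"
proof -
  obtain u where u: "u \<noteq> v" "e = closed_segment v u" "u extreme_point_of P"
    by (rule edge_of_polytope_at_vertex[OF poly, of e v]) (use assms in auto)
  then have "u \<in> e" by simp
  moreover have "h \<bullet> u \<noteq> h \<bullet> v" using inj_onD[OF inj, of u v] u assms by auto
  ultimately show ?thesis using assms(3) u that[of u] by (simp add: less_le)
qed

text \<open>A facet has at most two edges at \<open>v\<close> in any case. If it has a descending
  edge but also a point above \<open>v\<close>, it is crossed, and a second descending edge would
  confine it to heights up to that of \<open>v\<close>.\<close>

lemma card_down_edges_in_facet_le: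
  assumes inj: "inj_on (\<lambda>v. h \<bullet> v) V" and v: "v \<in> V" and \<sigma>: "\<sigma> \<in> Fs"
  shows "card {e \<in> down_edges h v. e \<subseteq> \<sigma>} \<le> 2 * of_bool (\<sigma> \<in> topped_facets h v) + of_bool (\<sigma> \<in> crossed_facets h v)"
proof -
  let ?D = "{e \<in> down_edges h v. e \<subseteq> \<sigma>}"
  have facet_\<sigma>: "\<sigma> facet_of P" using \<sigma> by simp
  consider (empty) "?D = {}" | (top) "\<sigma> \<in> topped_facets h v" | (cross) "?D \<noteq> {}" "\<sigma> \<notin> topped_facets h v" by blast
  then show ?thesis
  proof cases
    case empty
    then show ?thesis by (simp only: card.empty)
  next
    case top
    have "card ?D \<le> card {e \<in> Es. v \<in> e \<and> e \<subseteq> \<sigma>}"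
      by (rule card_mono) (use finite_Es in auto)
    also have "\<dots> \<le> 2" by (rule card_edges_at_vertex_le_2[OF v facet_\<sigma>])
    finally show ?thesis using top by simp
  next
    case cross
    then obtain e where e: "e \<in> down_edges h v" "e \<subseteq> \<sigma>" by blast
    obtain u where u: "u \<in> e" "e = closed_segment v u" "h \<bullet> u < h \<bullet> v"
      using lower_end_exists[OF inj v e(1)] .
    have v\<sigma>: "v \<in> \<sigma>" using e by blast
    then obtain y where y: "y \<in> \<sigma>" "h \<bullet> v < h \<bullet> y" using cross(2) \<sigma> by (auto simp: not_le)
    have "\<sigma> \<in> crossed_facets h v" using \<sigma> v\<sigma> u e y by blast
    moreover have "?D \<subseteq> {e}"
    proof
      fix e' assume "e' \<in> ?D"
      then have e': "e' \<in> down_edges h v" "e' \<subseteq> \<sigma>" by auto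
      obtain u' where u': "u' \<in> e'" "e' = closed_segment v u'" "h \<bullet> u' < h \<bullet> v"
        using lower_end_exists[OF inj v e'(1)] .
      show "e' \<in> {e}"
      proof (rule ccontr)
        assume "e' \<notin> {e}"
        then have "e \<noteq> e'" by simp
        have ends: "e edge_of P" "v \<in> e" "e' edge_of P" "v \<in> e'" using e e' by simp_all
        \<comment> \<open>The point \<open>y\<close> above \<open>v\<close> would lie in the cone of
          two descending directions.\<close>
        obtain c c' where c: "c \<ge> 0" "c' \<ge> 0" "y - v = c *\<^sub>R (u - v) + c' *\<^sub>R (u' - v)"
          using facet_in_edge_cone[OF v facet_\<sigma> ends(1,2) e(2) u(2) ends(3,4) e'(2) u'(2) \<open>e \<noteq> e'\<close> y(1)] .
        have "h \<bullet> (y - v) = c * (h \<bullet> u - h \<bullet> v) + c' * (h \<bullet> u' - h \<bullet> v)"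
          unfolding c(3) by (simp add: inner_add_right inner_diff_right)
        moreover have "c * (h \<bullet> u - h \<bullet> v) \<le> 0" "c' * (h \<bullet> u' - h \<bullet> v) \<le> 0"
          using c u u' by (simp_all add: mult_le_0_iff)
        ultimately show False using y by (simp add: inner_diff_right)
      qed
    qed
    then have "card ?D \<le> 1" using card_mono[of "{e}" ?D] by simp
    ultimately show ?thesis by simp
  qed
qed

text \<open>Double counting of the pairs of a descending edge at \<open>v\<close> and a facet containing it.\<close>

lemma two_card_down_le:
  assumes inj: "inj_on (\<lambda>v. h \<bullet> v) V" and v: "v \<in> V"
  shows "2 * card (down_edges h v) \<le> 2 * card (topped_facets h v) + card (crossed_facets h v)"
proof -
  have fin: "finite (down_edges h v)" using finite_Es by simp
  have "2 * card (down_edges h v) = (\<Sum>e\<in>down_edges h v. 2)" by simp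
  also have "\<dots> \<le> (\<Sum>e\<in>down_edges h v. card {\<sigma> \<in> Fs. e \<subseteq> \<sigma>})"
    by (intro sum_mono two_le_card_facets_through_edge) simp
  also have "\<dots> = (\<Sum>\<sigma>\<in>Fs. card {e \<in> down_edges h v. e \<subseteq> \<sigma>})"
    using fin finite_Fs by (intro sum_multicount_gen) auto
  also have "\<dots> \<le> (\<Sum>\<sigma>\<in>Fs. 2 * of_bool (\<sigma> \<in> topped_facets h v) + of_bool (\<sigma> \<in> crossed_facets h v))"
    by (intro sum_mono card_down_edges_in_facet_le[OF inj v])
  also have "\<dots> = 2 * (\<Sum>\<sigma>\<in>Fs. of_bool (\<sigma> \<in> topped_facets h v)) + (\<Sum>\<sigma>\<in>Fs. of_bool (\<sigma> \<in> crossed_facets h v))"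
    by (simp only: sum.distrib sum_distrib_left)
  also have "\<dots> = 2 * card (Fs \<inter> topped_facets h v) + card (Fs \<inter> crossed_facets h v)"
    using finite_Fs by (simp only: sum_of_bool_eq Collect_mem_eq) simp
  also have "\<dots> = 2 * card (topped_facets h v) + card (crossed_facets h v)"
    by (simp add: Int_absorb1 Collect_mono)
  finally show ?thesis .
qed

lemma vertex_maximizing:
  obtains v where "v \<in> V" "\<And>x. x \<in> P \<Longrightarrow> h \<bullet> x \<le> h \<bullet> v"
proof -
  have "V \<noteq> {}" using P_eq_hull int_P by force
  then have "Max ((\<bullet>) h ` V) \<in> (\<bullet>) h ` V" using finite_V by (intro Max_in) auto
  then obtain v where v: "v \<in> V" "Max ((\<bullet>) h ` V) = h \<bullet> v" by blast
  have "h \<bullet> u \<le> h \<bullet> v" if "u \<in> V" for u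
    unfolding v(2)[symmetric] using finite_V that by (intro Max_ge) auto
  then have "convex hull V \<subseteq> {x. h \<bullet> x \<le> h \<bullet> v}"
    by (intro hull_minimal) (auto simp: convex_halfspace_le)
  then show ?thesis using that[OF v(1)] P_eq_hull by blast
qed

text \<open>Sum the local bounds over all vertices. Every edge descends from its higher end, a facet
  has at most one top vertex, and the correction 1 occurs at all vertices but the highest and the
  lowest, that is \<open>card V - 2\<close> times.\<close>

lemma euler_inequality: "card Es + 2 \<le> card V + card Fs"
proof -
  obtain h where inj: "inj_on (\<lambda>v. h \<bullet> v) V" using finite_separating_functional[OF finite_V] .
  obtain t where t: "t \<in> V" "\<And>x. x \<in> P \<Longrightarrow> h \<bullet> x \<le> h \<bullet> t" using vertex_maximizing[of h] by blast
  obtain b where b: "b \<in> V" "\<And>x. x \<in> P \<Longrightarrow> h \<bullet> b \<le> h \<bullet> x" using vertex_maximizing[of "- h"] by auto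
  have "b \<noteq> t"
  proof
    assume "b = t"
    have "V \<subseteq> {t}"
    proof
      fix u assume u: "u \<in> V"
      then have "h \<bullet> u = h \<bullet> t" using t(2) b(2) vertex_in_P \<open>b = t\<close> by (simp add: order.antisym)
      then show "u \<in> {t}" using inj_onD[OF inj _ u t(1)] by simp
    qed
    then have "P \<subseteq> {t}" using hull_mono[of V "{t}" convex] P_eq_hull by simp
    then show False using aff_dim_subset[of P "{t}"] dim_P by simp
  qed
  \<comment> \<open>A crossed facet has points on both sides of \<open>v\<close>, so there is none
    at \<open>t\<close>; no edge descends from \<open>b\<close>. Elsewhere there are at most two
    crossed facets, and halving gives the 1.\<close>
  have down_le: "card (down_edges h v) \<le> card (topped_facets h v) + of_bool (v \<notin> {t, b})" if v: "v \<in> V" for v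
  proof -
    have le: "2 * card (down_edges h v) \<le> 2 * card (topped_facets h v) + card (crossed_facets h v)"
      using two_card_down_le[OF inj v] .
    consider "v = t" | "v = b" | "v \<notin> {t, b}" by blast
    then show ?thesis
    proof cases
      case 1
      have "crossed_facets h v = {}" using t(2) 1 facet_of_imp_subset by (fastforce simp: not_less)
      then have "card (crossed_facets h v) = 0" by (simp only: card.empty)
      then show ?thesis using le by linarith
    next
      case 2
      have "down_edges h v = {}"
      proof (rule ccontr)
        assume "down_edges h v \<noteq> {}"
        then obtain e where e: "e \<in> down_edges h v" by blast
        then obtain u where "u \<in> e" "h \<bullet> u < h \<bullet> v" using lower_end_exists[OF inj v e] by blast
        moreover have "e \<subseteq> P" using e edge_of_imp_subset by blast
        ultimately show False using b(2)[of u] 2 by auto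
      qed
      then have "card (down_edges h v) = 0" by (simp only: card.empty)
      then show ?thesis by linarith
    next
      case 3
      then show ?thesis using le card_crossed_facets_le_2[OF inj v] by simp
    qed
  qed
  have "Es \<subseteq> (\<Union>v\<in>V. down_edges h v)"
  proof
    fix e assume e: "e \<in> Es"
    then obtain u w where uw: "e = closed_segment u w" "u extreme_point_of P" "w extreme_point_of P"
      using edge_of_polytope_segment[OF poly] by blast
    have "h \<bullet> x \<le> max (h \<bullet> u) (h \<bullet> w)" if "x \<in> e" for x
    proof -
      have "e \<subseteq> {x. h \<bullet> x \<le> max (h \<bullet> u) (h \<bullet> w)}"
        unfolding uw(1) by (rule closed_segment_subset) (auto simp: convex_halfspace_le)
      then show ?thesis using that by blast
    qed
    then have "e \<in> down_edges h w \<or> e \<in> down_edges h u"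
      using e uw(1) by (cases "h \<bullet> u \<le> h \<bullet> w") (simp_all add: max_def)
    then show "e \<in> (\<Union>v\<in>V. down_edges h v)" using uw(2,3) by blast
  qed
  then have "card Es \<le> card (\<Union>v\<in>V. down_edges h v)"
    by (rule card_mono[rotated]) (use finite_V finite_Es in auto)
  also have "\<dots> \<le> (\<Sum>v\<in>V. card (down_edges h v))" by (rule card_UN_le[OF finite_V])
  also have "\<dots> \<le> (\<Sum>v\<in>V. card (topped_facets h v) + of_bool (v \<notin> {t, b}))"
    by (intro sum_mono down_le)
  also have "\<dots> = (\<Sum>v\<in>V. card (topped_facets h v)) + (\<Sum>v\<in>V. of_bool (v \<notin> {t, b}))"
    by (rule sum.distrib)
  also have "(\<Sum>v\<in>V. card (topped_facets h v)) = card (\<Union>v\<in>V. topped_facets h v)"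
  proof (rule card_UN_disjoint[symmetric])
    show "finite V" by (rule finite_V)
    show "\<forall>v\<in>V. finite (topped_facets h v)" using finite_Fs by simp
    show "\<forall>v\<in>V. \<forall>w\<in>V. v \<noteq> w \<longrightarrow> topped_facets h v \<inter> topped_facets h w = {}"
    proof (intro ballI impI)
      fix v w assume vw: "v \<in> V" "w \<in> V" "v \<noteq> w"
      then have "h \<bullet> v \<noteq> h \<bullet> w" using inj_onD[OF inj] by blast
      then show "topped_facets h v \<inter> topped_facets h w = {}" by fastforce
    qed
  qed
  also have "\<dots> \<le> card Fs" by (rule card_mono[OF finite_Fs]) blast
  also have "(\<Sum>v\<in>V. of_bool (v \<notin> {t, b})) = card (V - {t, b})"
  proof -
    have "V \<inter> {v. v \<notin> {t, b}} = V - {t, b}" by blast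
    then show ?thesis using finite_V by (simp only: sum_of_bool_eq of_nat_id)
  qed
  also have "card (V - {t, b}) = card V - 2"
    using t(1) b(1) \<open>b \<noteq> t\<close> finite_V by (subst card_Diff_subset) auto
  finally have "card Es \<le> card Fs + (card V - 2)" by simp
  moreover have "2 \<le> card V"
    using card_mono[OF finite_V, of "{t, b}"] t(1) b(1) \<open>b \<noteq> t\<close> by simp
  ultimately show ?thesis by linarith
qed

section \<open>Counting the constraints\<close>

abbreviation "Inc \<equiv> {(v, \<sigma>). v \<in> V \<and> \<sigma> \<in> Fs \<and> v \<in> \<sigma>}"

lemma finite_Inc: "finite Inc"
  by (rule finite_subset[of _ "V \<times> Fs"]) (use finite_V finite_Fs in auto)

text \<open>Double counting of flags (vertex, edge, facet): each incidence extends to at least two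
  flags, and each edge, with two ends and at most two facets, lies in at most four.\<close>

lemma card_Inc_le: "card Inc \<le> 2 * card Es"
proof -
  let ?R = "\<lambda>(v, \<sigma>) e. v \<in> e \<and> e \<subseteq> \<sigma>"
  have "2 * card Inc = (\<Sum>i\<in>Inc. 2)" by simp
  also have "\<dots> \<le> (\<Sum>i\<in>Inc. card {e \<in> Es. ?R i e})"
    by (intro sum_mono) (auto intro!: two_le_card_edges_at_vertex[simplified])
  also have "\<dots> = (\<Sum>e\<in>Es. card {i \<in> Inc. ?R i e})"
    using finite_Inc finite_Es by (intro sum_multicount_gen) auto
  also have "\<dots> \<le> (\<Sum>e\<in>Es. 4)"
  proof (rule sum_mono)
    fix e assume e: "e \<in> Es"
    then obtain u w where uw: "e = closed_segment u w"
      using edge_of_polytope_segment[OF poly] by blast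
    have "v \<in> {u, w}" if "v \<in> V" "v \<in> e" for v
    proof -
      have "v extreme_point_of e" using that e extreme_point_of_face[of e P v] by (simp add: edge_of_def)
      then show ?thesis by (simp add: uw extreme_point_of_segment)
    qed
    then have "{i \<in> Inc. ?R i e} \<subseteq> {u, w} \<times> {\<sigma> \<in> Fs. e \<subseteq> \<sigma>}" by blast
    then have "card {i \<in> Inc. ?R i e} \<le> card ({u, w} \<times> {\<sigma> \<in> Fs. e \<subseteq> \<sigma>})"
      by (rule card_mono[rotated]) (use finite_Fs in auto)
    also have "\<dots> = card {u, w} * card {\<sigma> \<in> Fs. e \<subseteq> \<sigma>}" by (rule card_cartesian_product)
    also have "\<dots> \<le> 2 * 2"
      using card_facets_through_edge_le_2[of e] e card_insert_le_m1[of 2 "{w}" u] by (intro mult_mono) auto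
    finally show "card {i \<in> Inc. ?R i e} \<le> 4" by simp
  qed
  finally show ?thesis by simp
qed

text \<open>With \<open>E\<close>, \<open>V\<close> and \<open>F\<close> for the numbers of faces,
  the left side is at most \<open>3 * E + 6 = 3 * (E + 2)\<close>, so the Euler inequality applies.
  The 6 counts the normalizations that remove infinitesimal isometries.\<close>

lemma card_constraints_le: "card Es + card Inc + 6 \<le> 3 * card V + 3 * card Fs"
  using euler_inequality card_Inc_le by linarith

end

section \<open>The linearized constraints\<close>

text \<open>After \<open>p w0 = 0\<close>, triviality says that the form
  \<open>p u \<bullet> (v - w0)\<close> is skew-symmetric on \<open>V\<close>. The other three
  normalizations kill its entries above the diagonal on \<open>w1\<close>, \<open>w2\<close>,
  \<open>w3\<close>, so skew symmetry gives \<open>p = 0\<close> at these points in turn, and then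
  at every vertex.\<close>

lemma normalized_trivial_motion_eq_0:
  fixes p :: "'a::real_inner \<Rightarrow> 'a"
  assumes triv: "\<And>u v. u \<in> V \<Longrightarrow> v \<in> V \<Longrightarrow> (u - v) \<bullet> (p u - p v) = 0"
    and V: "w0 \<in> V" "w1 \<in> V" "w2 \<in> V" "w3 \<in> V"
    and span: "\<And>x. x \<bullet> (w1 - w0) = 0 \<Longrightarrow> x \<bullet> (w2 - w0) = 0 \<Longrightarrow> x \<bullet> (w3 - w0) = 0 \<Longrightarrow> x = 0"
    and norm: "p w0 = 0" "p w1 \<bullet> (w2 - w0) = 0" "p w1 \<bullet> (w3 - w0) = 0" "p w2 \<bullet> (w3 - w0) = 0"
    and "v \<in> V"
  shows "p v = 0"
proof -
  have diag: "p u \<bullet> (u - w0) = 0" if "u \<in> V" for u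
    using triv[OF that V(1)] norm(1) by (simp add: inner_commute)
  have skew: "p u \<bullet> (v - w0) = - (p v \<bullet> (u - w0))" if "u \<in> V" "v \<in> V" for u v
  proof -
    have "(u - v) \<bullet> (p u - p v) = p u \<bullet> (u - w0) - p v \<bullet> (u - w0) - p u \<bullet> (v - w0) + p v \<bullet> (v - w0)"
      by (simp add: inner_diff_left inner_diff_right inner_commute)
    then show ?thesis using triv diag that by simp
  qed
  have "p w1 = 0" by (rule span) (use diag[OF V(2)] norm in auto)
  moreover have "p w2 = 0"
    by (rule span) (use diag[OF V(3)] skew[OF V(3,2)] norm in auto)
  moreover have "p w3 = 0"
    by (rule span) (use diag[OF V(4)] skew[OF V(4,2)] skew[OF V(4,3)] norm in auto)
  ultimately show ?thesis
    using skew[OF \<open>v \<in> V\<close> V(2)] skew[OF \<open>v \<in> V\<close> V(3)] skew[OF \<open>v \<in> V\<close> V(4)] by (intro span) auto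
qed

context polytope3
begin

abbreviation "\<C> \<equiv> polytope_type P"

lemma polytope_type_sel [simp]: "vertices \<C> = V" "facets \<C> = Fs" "incident \<C> = (\<in>)"
  by (simp_all add: polytope_type_def)

lemma edges_eq: "edges \<C> = {{u, v} | u v. closed_segment u v edge_of P}"
  by (simp add: polytope_type_def)

lemma polytope_config_eq: "polytope_config P = ((\<lambda>v\<in>V. v), (\<lambda>\<sigma>\<in>Fs. N \<sigma>))"
  by (simp add: polytope_config_def)

lemma edge_ends_in_V:
  assumes "{u, v} \<in> edges \<C>"
  shows "u \<in> V" "v \<in> V"
proof -
  obtain a b where ab: "{u, v} = {a, b}" "closed_segment a b edge_of P" using assms by (auto simp: edges_eq)
  then have "a \<in> V" "b \<in> V"
    using extreme_point_of_face[of "closed_segment a b" P] by (auto simp: edge_of_def extreme_point_of_segment)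
  then show "u \<in> V" "v \<in> V" using ab(1) by (auto simp: doubleton_eq_iff)
qed

text \<open>Elements of \<open>edges \<C>\<close> are pairs of end points, elements of
  \<open>Es\<close> are faces. The end points are the extreme points of the face, so taking extreme
  points maps \<open>Es\<close> onto a set containing \<open>edges \<C>\<close>.\<close>

lemma finite_edges: "finite (edges \<C>)" and card_edges_le: "card (edges \<C>) \<le> card Es"
proof -
  have sub: "edges \<C> \<subseteq> (\<lambda>e. {x. x extreme_point_of e}) ` Es"
  proof
    fix e assume "e \<in> edges \<C>"
    then obtain u v where uv: "e = {u, v}" "closed_segment u v \<in> Es" by (auto simp: edges_eq)
    then have "e = {x. x extreme_point_of closed_segment u v}" by (auto simp: extreme_point_of_segment)
    then show "e \<in> (\<lambda>e. {x. x extreme_point_of e}) ` Es" using uv(2) by (rule image_eqI)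
  qed
  then show "finite (edges \<C>)" using finite_Es finite_surj by blast
  show "card (edges \<C>) \<le> card Es" using sub finite_Es by (rule surj_card_le[rotated])
qed

text \<open>The vertices affinely span the space, so a basis can be chosen among their differences
  to \<open>w0\<close>, and a vector orthogonal to a basis is zero.\<close>

lemma vertex_frame:
  obtains w0 w1 w2 w3 where "w0 \<in> V" "w1 \<in> V" "w2 \<in> V" "w3 \<in> V"
    "\<And>x. x \<bullet> (w1 - w0) = 0 \<Longrightarrow> x \<bullet> (w2 - w0) = 0 \<Longrightarrow> x \<bullet> (w3 - w0) = 0 \<Longrightarrow> x = 0"
proof -
  obtain w0 where w0: "w0 \<in> V" using vertex_maximizing by blast
  let ?D = "(\<lambda>v. v - w0) ` V"
  have "aff_dim V = 3" using aff_dim_convex_hull[of V] P_eq_hull dim_P by simp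
  then have D: "dim ?D = 3" using aff_dim_eq_dim_subtract[of w0 V] w0 by (simp add: hull_inc)
  obtain B where B: "B \<subseteq> ?D" "independent B" "?D \<subseteq> span B" "card B = dim ?D"
    using basis_exists[of ?D] by blast
  obtain b1 b2 b3 where b: "B = {b1, b2, b3}" using B(4) D by (auto simp: card_3_iff)
  then have "b1 \<in> ?D" "b2 \<in> ?D" "b3 \<in> ?D" using B(1) by auto
  then obtain w1 w2 w3 where w: "w1 \<in> V" "w2 \<in> V" "w3 \<in> V" "b1 = w1 - w0" "b2 = w2 - w0" "b3 = w3 - w0"
    by blast
  have "dim B = 3" using dim_eq_card_independent[OF B(2)] B(4) D by linarith
  then have span: "span B = UNIV" using dim_eq_full[of B] by simp
  have "x = 0" if "x \<bullet> b1 = 0" "x \<bullet> b2 = 0" "x \<bullet> b3 = 0" for x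
  proof -
    have "B \<subseteq> {y. x \<bullet> y = 0}" unfolding b using that by simp
    then have "span B \<subseteq> {y. x \<bullet> y = 0}" by (rule span_minimal[OF _ subspace_hyperplane])
    then have "x \<bullet> x = 0" unfolding span by blast
    then show "x = 0" by simp
  qed
  then show ?thesis using that[OF w0 w(1-3)] unfolding w(4-6) by blast
qed

text \<open>Both \<open>N \<sigma>\<close> and \<open>N \<sigma> + a\<close> take the value 1 on the
  whole facet, so they agree by uniqueness of the normal. Hence a motion that fixes all vertices
  fixes all facets.\<close>

lemma facet_normal_motion_eq_0:
  assumes "\<sigma> \<in> Fs" "\<And>v. v \<in> V \<Longrightarrow> v \<in> \<sigma> \<Longrightarrow> v \<bullet> a = 0"
  shows "a = 0"
proof -
  have \<sigma>: "\<sigma> facet_of P" using assms by simp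
  have "\<sigma> = convex hull {v. v extreme_point_of \<sigma>}"
    using facet(4)[OF \<sigma>] by (intro Krein_Milman_Minkowski polytope_imp_compact polytope_imp_convex)
  moreover have "{v. v extreme_point_of \<sigma>} \<subseteq> {x. a \<bullet> x = 0}"
    using assms(2) extreme_point_of_face[OF facet(1)[OF \<sigma>]] by (auto simp: inner_commute)
  ultimately have "\<sigma> \<subseteq> {x. a \<bullet> x = 0}" by (metis hull_minimal convex_hyperplane)
  moreover have "\<sigma> \<subseteq> {x. N \<sigma> \<bullet> x = 1}" using facet_normal(2)[OF poly dim_P int_P \<sigma>] by blast
  ultimately have "\<sigma> \<subseteq> {x. (N \<sigma> + a) \<bullet> x = 1}" by (fastforce simp: inner_add_left)
  then have "N \<sigma> + a = N \<sigma>"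
    using facet_normal_unique[OF facet(2)[OF \<sigma>]] \<open>\<sigma> \<subseteq> {x. N \<sigma> \<bullet> x = 1}\<close> by blast
  then show ?thesis by simp
qed

text \<open>Rigidity for arbitrary functions; the extensional maps demanded by
  \<open>first_order_motion\<close> are obtained by restriction.\<close>

lemma rigid_motion_trivial:
  assumes rigid: "first_order_rigid P"
    and edge: "\<And>u v. {u, v} \<in> edges \<C> \<Longrightarrow> (u - v) \<bullet> (p u - p v) = 0"
    and inc: "\<And>v \<sigma>. v \<in> V \<Longrightarrow> \<sigma> \<in> Fs \<Longrightarrow> v \<in> \<sigma> \<Longrightarrow> v \<bullet> a \<sigma> + p v \<bullet> N \<sigma> = 0"
    and uv: "u \<in> V" "v \<in> V"
  shows "(u - v) \<bullet> (p u - p v) = 0"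
proof -
  have "first_order_motion \<C> (polytope_config P) (restrict p V, restrict a Fs)"
    using edge inc edge_ends_in_V by (auto simp: first_order_motion_def polytope_config_eq)
  then have "trivial_motion \<C> (polytope_config P) (restrict p V, restrict a Fs)"
    using rigid by (simp add: first_order_rigid_def first_order_rigid_config_def)
  then show ?thesis using uv by (simp add: trivial_motion_def polytope_config_eq)
qed

text \<open>With the six normalizations added, the homogeneous system has only the zero solution: by
  rigidity a solution is a trivial motion, the normalizations annihilate its vertex part, and then
  its facet part vanishes. Since there are no more equations than unknowns, every right-hand side is
  attained.\<close>

lemma linearized_system_surjective:
  assumes rigid: "first_order_rigid P"
  obtains p a where "\<And>u v. {u, v} \<in> edges \<C> \<Longrightarrow> (u - v) \<bullet> (p u - p v) = y (Inl {u, v})"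
    and "\<And>v \<sigma>. (v, \<sigma>) \<in> Inc \<Longrightarrow> v \<bullet> a \<sigma> + p v \<bullet> N \<sigma> = y (Inr (v, \<sigma>))"
proof -
  obtain w0 w1 w2 w3 where w: "w0 \<in> V" "w1 \<in> V" "w2 \<in> V" "w3 \<in> V"
    and frame: "\<And>x. x \<bullet> (w1 - w0) = 0 \<Longrightarrow> x \<bullet> (w2 - w0) = 0 \<Longrightarrow> x \<bullet> (w3 - w0) = 0 \<Longrightarrow> x = 0"
    using vertex_frame by blast
  \<comment> \<open>An arbitrary orientation of each edge; the edge functional does not depend on
    it.\<close>
  have "\<exists>f. \<forall>e\<in>edges \<C>. e = {fst (f e), snd (f e)}"
    by (rule bchoice) (auto simp: edges_eq)
  then obtain f where f: "\<And>e. e \<in> edges \<C> \<Longrightarrow> e = {fst (f e), snd (f e)}" by blast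
  define pp :: "((real^3) \<times> 3 + (real^3) set \<times> 3 \<Rightarrow> real) \<Rightarrow> real^3 \<Rightarrow> real^3"
    where "pp x v = (\<chi> c. x (Inl (v, c)))" for x v
  define aa :: "((real^3) \<times> 3 + (real^3) set \<times> 3 \<Rightarrow> real) \<Rightarrow> (real^3) set \<Rightarrow> real^3"
    where "aa x \<sigma> = (\<chi> c. x (Inr (\<sigma>, c)))" for x \<sigma>
  have pp_lin: "pp (\<lambda>i. x i + y i) v = pp x v + pp y v" "pp (\<lambda>i. c * x i) v = c *\<^sub>R pp x v" for x y v c
    by (simp_all add: pp_def vec_eq_iff)
  have aa_lin: "aa (\<lambda>i. x i + y i) v = aa x v + aa y v" "aa (\<lambda>i. c * x i) v = c *\<^sub>R aa x v" for x y v c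
    by (simp_all add: aa_def vec_eq_iff)
  \<comment> \<open>\<open>pp x w0\<close> and \<open>rot (pp x)\<close> are the six functionals whose only common zero among the infinitesimal isometries is 0\<close>
  define rot :: "(real^3 \<Rightarrow> real^3) \<Rightarrow> 3 \<Rightarrow> real" where
    "rot p c = (if c = 1 then p w1 \<bullet> (w2 - w0) else if c = 2 then p w1 \<bullet> (w3 - w0) else p w2 \<bullet> (w3 - w0))" for p c
  define edge :: "(real^3 \<Rightarrow> real^3) \<Rightarrow> (real^3) set \<Rightarrow> real" where
    "edge p e = (fst (f e) - snd (f e)) \<bullet> (p (fst (f e)) - p (snd (f e)))" for p e
  have edge: "edge p {u, v} = (u - v) \<bullet> (p u - p v)" if "{u, v} \<in> edges \<C>" for u v p
    using f[OF that] unfolding edge_def doubleton_eq_iff by (auto simp: inner_diff_left inner_diff_right)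
  \<comment> \<open>The rows are indexed by edges, incidences, three translational and three
    rotational normalizations.\<close>
  define \<phi> :: "(real^3) set + ((real^3) \<times> (real^3) set + (3 + 3)) \<Rightarrow> _ \<Rightarrow> real" where
    "\<phi> k x = (case k of Inl e \<Rightarrow> edge (pp x) e
      | Inr (Inl (v, \<sigma>)) \<Rightarrow> v \<bullet> aa x \<sigma> + pp x v \<bullet> N \<sigma>
      | Inr (Inr (Inl c)) \<Rightarrow> pp x w0 $ c
      | Inr (Inr (Inr c)) \<Rightarrow> rot (pp x) c)" for k x
  define K where "K = edges \<C> <+> (Inc <+> (UNIV :: (3 + 3) set))"
  have in_K: "Inl e \<in> K \<longleftrightarrow> e \<in> edges \<C>" "Inr (Inl i) \<in> K \<longleftrightarrow> i \<in> Inc" "Inr (Inr j) \<in> K" for e i j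
    by (auto simp: K_def)
  define I where "I = V \<times> (UNIV :: 3 set) <+> Fs \<times> (UNIV :: 3 set)"
  have fin: "finite K" "finite I"
    unfolding K_def I_def by (intro finite_Plus finite_cartesian_product finite_edges finite_Inc finite_V finite_Fs finite)+
  have card6: "card (UNIV :: (3 + 3) set) = 6"
    unfolding UNIV_Plus_UNIV[symmetric] by (simp add: card_Plus)
  have "card K = card (edges \<C>) + (card Inc + 6)"
    unfolding K_def by (simp only: card_Plus finite_edges finite_Inc finite finite_Plus card6)
  moreover have "card I = card V * 3 + card Fs * 3"
    unfolding I_def
    by (subst card_Plus) (simp_all add: finite_V finite_Fs finite_cartesian_product card_cartesian_product)
  ultimately have card: "card K \<le> card I" using card_constraints_le card_edges_le by linarith
  \<comment> \<open>The prescribed values, with 0 for the normalizations.\<close>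
  define y' where "y' k = (case k of Inl e \<Rightarrow> y (Inl e) | Inr (Inl i) \<Rightarrow> y (Inr i) | Inr (Inr _) \<Rightarrow> 0)"
    for k :: "(real^3) set + ((real^3) \<times> (real^3) set + (3 + 3))"
  have "\<exists>x. \<forall>k\<in>K. \<phi> k x = y' k"
    using fin card
  proof (rule injective_functionals_surjective)
    show "\<phi> k (\<lambda>i. x i + y i) = \<phi> k x + \<phi> k y" for k x y
      by (simp add: \<phi>_def edge_def rot_def pp_lin aa_lin inner_add_left inner_add_right inner_diff_right
          split: sum.split prod.split)
    show "\<phi> k (\<lambda>i. c * x i) = c * \<phi> k x" for k c x
      by (simp add: \<phi>_def edge_def rot_def pp_lin aa_lin inner_diff_right right_diff_distrib distrib_left
          split: sum.split prod.split)
    fix x assume zero: "\<And>k. k \<in> K \<Longrightarrow> \<phi> k x = 0"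
    have zero_edge: "(u - v) \<bullet> (pp x u - pp x v) = 0" if "{u, v} \<in> edges \<C>" for u v
      using zero[of "Inl {u, v}"] edge[OF that] that by (simp add: in_K \<phi>_def)
    have zero_inc: "v \<bullet> aa x \<sigma> + pp x v \<bullet> N \<sigma> = 0" if "v \<in> V" "\<sigma> \<in> Fs" "v \<in> \<sigma>" for v \<sigma>
      using zero[of "Inr (Inl (v, \<sigma>))"] that by (simp add: in_K \<phi>_def)
    have "pp x w0 $ c = 0" for c using zero[of "Inr (Inr (Inl c))"] by (simp add: in_K \<phi>_def)
    then have zero_w0: "pp x w0 = 0" by (simp add: vec_eq_iff)
    have zero_rot: "rot (pp x) c = 0" for c using zero[of "Inr (Inr (Inr c))"] by (simp add: in_K \<phi>_def)
    have p0: "pp x v = 0" if "v \<in> V" for v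
      using rigid_motion_trivial[OF rigid zero_edge zero_inc] w frame zero_w0 _ _ _ that
    proof (rule normalized_trivial_motion_eq_0)
      show "pp x w1 \<bullet> (w2 - w0) = 0" "pp x w1 \<bullet> (w3 - w0) = 0" "pp x w2 \<bullet> (w3 - w0) = 0"
        using zero_rot[of 1] zero_rot[of 2] zero_rot[of 3] by (simp_all add: rot_def)
    qed
    have a0: "aa x \<sigma> = 0" if "\<sigma> \<in> Fs" for \<sigma>
      using zero_inc p0 that by (intro facet_normal_motion_eq_0[OF that]) fastforce
    show "\<forall>i\<in>I. x i = 0"
      using p0 a0 by (auto simp: I_def pp_def aa_def vec_eq_iff)
  qed
  then obtain x where x: "\<And>k. k \<in> K \<Longrightarrow> \<phi> k x = y' k" by blast
  show ?thesis
  proof (rule that)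
    show "(u - v) \<bullet> (pp x u - pp x v) = y (Inl {u, v})" if "{u, v} \<in> edges \<C>" for u v
      using x[of "Inl {u, v}"] edge[OF that] that by (simp add: in_K \<phi>_def y'_def)
    show "v \<bullet> aa x \<sigma> + pp x v \<bullet> N \<sigma> = y (Inr (v, \<sigma>))" if "(v, \<sigma>) \<in> Inc" for v \<sigma>
      using x[of "Inr (Inl (v, \<sigma>))"] that by (simp add: in_K \<phi>_def y'_def)
  qed
qed

end

section \<open>Local surjectivity\<close>

text \<open>Radii are handled through the filter \<open>at_right 0\<close>, so that finitely many
  smallness conditions combine without explicit minima.\<close>

lemma eventually_ball_subset:
  assumes "open U" "x \<in> U"
  shows "\<forall>\<^sub>F \<eta> in at_right (0::real). ball x \<eta> \<subseteq> U"
proof -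
  obtain e where "e > 0" "ball x e \<subseteq> U" using assms openE by blast
  then have "\<forall>\<eta>. 0 < \<eta> \<and> \<eta> < e \<longrightarrow> ball x \<eta> \<subseteq> U"
    by (meson less_imp_le subset_ball subset_trans)
  then show ?thesis using \<open>e > 0\<close> by (auto simp: eventually_at_right_field)
qed

lemma eventually_inner_less:
  fixes x y :: "'a::real_inner"
  assumes "x \<bullet> y < c"
  shows "\<forall>\<^sub>F \<eta> in at_right (0::real). \<forall>x'\<in>ball x \<eta>. \<forall>y'\<in>ball y \<eta>. x' \<bullet> y' < c"
proof -
  have "open {z :: 'a \<times> 'a. fst z \<bullet> snd z < c}"
    by (intro open_Collect_less continuous_intros)
  moreover have "(x, y) \<in> {z. fst z \<bullet> snd z < c}" using assms by simp
  ultimately obtain A B where AB: "open A" "open B" "(x, y) \<in> A \<times> B" "A \<times> B \<subseteq> {z. fst z \<bullet> snd z < c}"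
    by (rule open_prod_elim)
  have "\<forall>\<^sub>F \<eta> in at_right (0::real). ball x \<eta> \<subseteq> A \<and> ball y \<eta> \<subseteq> B"
    using AB by (intro eventually_conj eventually_ball_subset) auto
  then show ?thesis
  proof eventually_elim
    case (elim \<eta>)
    show ?case
    proof (intro ballI)
      fix x' y' assume "x' \<in> ball x \<eta>" "y' \<in> ball y \<eta>"
      then have "(x', y') \<in> A \<times> B" using elim by blast
      then show "x' \<bullet> y' < c" using AB(4) by fastforce
    qed
  qed
qed

lemma product_topology_nhd_box:
  fixes p :: "'v \<Rightarrow> 'a::metric_space"
  assumes "openin (product_topology (\<lambda>_. euclidean) A) U" "p \<in> U" "finite A"
  shows "\<forall>\<^sub>F \<eta> in at_right (0::real). (\<Pi>\<^sub>E v\<in>A. ball (p v) \<eta>) \<subseteq> U"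
proof -
  obtain B where B: "\<And>v. v \<in> A \<Longrightarrow> open (B v)" "p \<in> Pi\<^sub>E A B" "Pi\<^sub>E A B \<subseteq> U"
    using bspec[OF assms(1)[unfolded openin_product_topology_alt] assms(2)]
    unfolding open_openin[symmetric] by blast
  have "\<forall>\<^sub>F \<eta> in at_right (0::real). \<forall>v\<in>A. ball (p v) \<eta> \<subseteq> B v"
    using B assms(3) by (intro eventually_ball_finite ballI eventually_ball_subset) (auto dest: PiE_mem)
  then show ?thesis
  proof eventually_elim
    case (elim \<eta>)
    then have "(\<Pi>\<^sub>E v\<in>A. ball (p v) \<eta>) \<subseteq> Pi\<^sub>E A B" by (intro PiE_mono) blast
    then show ?case using B(3) by blast
  qed
qed

text \<open>The strict inequalities are open conditions, finitely many in number, so in a small box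
  around a realization only the incidence equations have to be checked.\<close>

lemma realization_topology_nhd_box:
  assumes fin: "finite (vertices C)" "finite (facets C)"
    and W: "openin (realization_topology C) W" "(p, a) \<in> W"
  obtains \<eta> where "\<eta> > 0"
    and "\<And>q b. q \<in> (\<Pi>\<^sub>E v\<in>vertices C. ball (p v) \<eta>) \<Longrightarrow> b \<in> (\<Pi>\<^sub>E \<sigma>\<in>facets C. ball (a \<sigma>) \<eta>) \<Longrightarrow>
      (\<And>v \<sigma>. v \<in> vertices C \<Longrightarrow> \<sigma> \<in> facets C \<Longrightarrow> incident C v \<sigma> \<Longrightarrow> q v \<bullet> b \<sigma> = 1) \<Longrightarrow> (q, b) \<in> W"
proof -
  obtain S where S: "openin (config_topology C) S" "W = S \<inter> realization_space C"
    using W(1) by (auto simp: realization_topology_def openin_subtopology)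
  obtain U1 U2 where U: "openin (product_topology (\<lambda>_. euclidean) (vertices C)) U1"
    "openin (product_topology (\<lambda>_. euclidean) (facets C)) U2" "p \<in> U1" "a \<in> U2" "U1 \<times> U2 \<subseteq> S"
  proof -
    have "(p, a) \<in> S" using S(2) W(2) by blast
    from openin_prod_topology_alt[THEN iffD1, rule_format, OF S(1)[unfolded config_topology_def] this]
    show ?thesis using that by blast
  qed
  have strict: "p v \<bullet> a \<sigma> < 1" if "v \<in> vertices C" "\<sigma> \<in> facets C" "\<not> incident C v \<sigma>" for v \<sigma>
    using W(2) S(2) that by (auto simp: realization_space_def)
  have "\<forall>\<^sub>F \<eta> in at_right (0::real). \<forall>v\<in>vertices C. \<forall>\<sigma>\<in>facets C.
      \<not> incident C v \<sigma> \<longrightarrow> (\<forall>x\<in>ball (p v) \<eta>. \<forall>y\<in>ball (a \<sigma>) \<eta>. x \<bullet> y < 1)"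
  proof (intro eventually_ball_finite fin ballI)
    fix v \<sigma> assume "v \<in> vertices C" "\<sigma> \<in> facets C"
    then show "\<forall>\<^sub>F \<eta> in at_right (0::real).
        \<not> incident C v \<sigma> \<longrightarrow> (\<forall>x\<in>ball (p v) \<eta>. \<forall>y\<in>ball (a \<sigma>) \<eta>. x \<bullet> y < 1)"
      using eventually_inner_less[OF strict] by (cases "incident C v \<sigma>") auto
  qed
  moreover have "\<forall>\<^sub>F \<eta> in at_right (0::real). \<eta> > 0" by (rule eventually_at_right_less)
  ultimately have "\<forall>\<^sub>F \<eta> in at_right (0::real). \<eta> > 0 \<and>
      (\<forall>v\<in>vertices C. \<forall>\<sigma>\<in>facets C.
        \<not> incident C v \<sigma> \<longrightarrow> (\<forall>x\<in>ball (p v) \<eta>. \<forall>y\<in>ball (a \<sigma>) \<eta>. x \<bullet> y < 1)) \<and>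
      (\<Pi>\<^sub>E v\<in>vertices C. ball (p v) \<eta>) \<subseteq> U1 \<and> (\<Pi>\<^sub>E \<sigma>\<in>facets C. ball (a \<sigma>) \<eta>) \<subseteq> U2"
    using U fin by (intro eventually_conj product_topology_nhd_box)
  then have "\<exists>\<eta>::real. \<eta> > 0 \<and>
      (\<forall>v\<in>vertices C. \<forall>\<sigma>\<in>facets C.
        \<not> incident C v \<sigma> \<longrightarrow> (\<forall>x\<in>ball (p v) \<eta>. \<forall>y\<in>ball (a \<sigma>) \<eta>. x \<bullet> y < 1)) \<and>
      (\<Pi>\<^sub>E v\<in>vertices C. ball (p v) \<eta>) \<subseteq> U1 \<and> (\<Pi>\<^sub>E \<sigma>\<in>facets C. ball (a \<sigma>) \<eta>) \<subseteq> U2"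
    by (rule eventually_happens'[OF trivial_limit_at_right_real])
  then obtain \<eta> where \<eta>: "\<eta> > 0"
    "\<forall>v\<in>vertices C. \<forall>\<sigma>\<in>facets C.
      \<not> incident C v \<sigma> \<longrightarrow> (\<forall>x\<in>ball (p v) \<eta>. \<forall>y\<in>ball (a \<sigma>) \<eta>. x \<bullet> y < 1)"
    "(\<Pi>\<^sub>E v\<in>vertices C. ball (p v) \<eta>) \<subseteq> U1" "(\<Pi>\<^sub>E \<sigma>\<in>facets C. ball (a \<sigma>) \<eta>) \<subseteq> U2"
    by (elim exE conjE) (rule that)
  show ?thesis
  proof (rule that[OF \<eta>(1)])
    fix q b assume q: "q \<in> (\<Pi>\<^sub>E v\<in>vertices C. ball (p v) \<eta>)" and b: "b \<in> (\<Pi>\<^sub>E \<sigma>\<in>facets C. ball (a \<sigma>) \<eta>)"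
      and inc: "\<And>v \<sigma>. v \<in> vertices C \<Longrightarrow> \<sigma> \<in> facets C \<Longrightarrow> incident C v \<sigma> \<Longrightarrow> q v \<bullet> b \<sigma> = 1"
    have "q v \<bullet> b \<sigma> < 1" if "v \<in> vertices C" "\<sigma> \<in> facets C" "\<not> incident C v \<sigma>" for v \<sigma>
      using \<eta>(2) that PiE_mem[OF q that(1)] PiE_mem[OF b that(2)] by simp
    moreover have "q \<in> vertices C \<rightarrow>\<^sub>E UNIV" "b \<in> facets C \<rightarrow>\<^sub>E UNIV" using q b by (auto simp: PiE_def)
    ultimately have "(q, b) \<in> realization_space C" using inc by (simp add: realization_space_def)
    moreover have "(q, b) \<in> S" using q b \<eta>(3,4) U(5) by blast
    ultimately show "(q, b) \<in> W" using S(2) by blast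
  qed
qed

section \<open>Solving the constraints near the polytope\<close>

context polytope3
begin

text \<open>Solving for each unit vector separately gives the columns \<open>(p k, a k)\<close> of a
  linear right inverse.\<close>

lemma linearized_right_inverse:
  assumes rigid: "first_order_rigid P"
  obtains p a where "\<And>k u v. {u, v} \<in> edges \<C> \<Longrightarrow> (u - v) \<bullet> (p k u - p k v) = of_bool (k = Inl {u, v})"
    and "\<And>k v \<sigma>. (v, \<sigma>) \<in> Inc \<Longrightarrow> v \<bullet> a k \<sigma> + p k v \<bullet> N \<sigma> = of_bool (k = Inr (v, \<sigma>))"
proof -
  have "\<exists>X. (\<forall>u v. {u, v} \<in> edges \<C> \<longrightarrow> (u - v) \<bullet> (fst X u - fst X v) = of_bool (k = Inl {u, v})) \<and>
      (\<forall>v \<sigma>. (v, \<sigma>) \<in> Inc \<longrightarrow> v \<bullet> snd X \<sigma> + fst X v \<bullet> N \<sigma> = of_bool (k = Inr (v, \<sigma>)))" for k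
  proof -
    show ?thesis
    proof (rule linearized_system_surjective[OF rigid, of "\<lambda>l. of_bool (k = l)"])
      fix p a assume "\<And>u v. {u, v} \<in> edges \<C> \<Longrightarrow> (u - v) \<bullet> (p u - p v) = of_bool (k = Inl {u, v})"
        "\<And>v \<sigma>. (v, \<sigma>) \<in> Inc \<Longrightarrow> v \<bullet> a \<sigma> + p v \<bullet> N \<sigma> = of_bool (k = Inr (v, \<sigma>))"
      then show ?thesis by (intro exI[of _ "(p, a)"]) simp
    qed
  qed
  then have "\<exists>X. \<forall>k. (\<forall>u v. {u, v} \<in> edges \<C> \<longrightarrow> (u - v) \<bullet> (fst (X k) u - fst (X k) v) = of_bool (k = Inl {u, v})) \<and>
      (\<forall>v \<sigma>. (v, \<sigma>) \<in> Inc \<longrightarrow> v \<bullet> snd (X k) \<sigma> + fst (X k) v \<bullet> N \<sigma> = of_bool (k = Inr (v, \<sigma>)))"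
    by (intro choice allI)
  then obtain X where X: "\<forall>k. (\<forall>u v. {u, v} \<in> edges \<C> \<longrightarrow> (u - v) \<bullet> (fst (X k) u - fst (X k) v) = of_bool (k = Inl {u, v})) \<and>
      (\<forall>v \<sigma>. (v, \<sigma>) \<in> Inc \<longrightarrow> v \<bullet> snd (X k) \<sigma> + fst (X k) v \<bullet> N \<sigma> = of_bool (k = Inr (v, \<sigma>)))" ..
  show ?thesis
  proof (rule that)
    show "(u - v) \<bullet> (fst (X k) u - fst (X k) v) = of_bool (k = Inl {u, v})" if "{u, v} \<in> edges \<C>" for k u v
      using spec[OF X, of k] that by simp
    show "v \<bullet> snd (X k) \<sigma> + fst (X k) v \<bullet> N \<sigma> = of_bool (k = Inr (v, \<sigma>))" if "(v, \<sigma>) \<in> Inc" for k v \<sigma>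
      using spec[OF X, of k] that by simp
  qed
qed

text \<open>Search for the solution as the given configuration plus a combination of the columns of
  the right inverse with coefficients \<open>u\<close>. The linear part of the constraints is then
  the identity in \<open>u\<close>, and what remains is a system \<open>u + Q u = y'\<close>,
  solvable for small \<open>y'\<close>.\<close>

lemma perturbations_of_rigid:
  assumes rigid: "first_order_rigid P" and "\<eta> > 0"
  obtains \<delta> where "\<delta> > 0"
    and "\<And>y. (\<And>e. e \<in> edges \<C> \<Longrightarrow> \<bar>y e - half_sq_length id e\<bar> < \<delta>) \<Longrightarrow>
      \<exists>q b. (\<forall>v\<in>V. q v \<in> ball v \<eta>) \<and> (\<forall>\<sigma>\<in>Fs. b \<sigma> \<in> ball (N \<sigma>) \<eta>) \<and>
        (\<forall>(v, \<sigma>)\<in>Inc. q v \<bullet> b \<sigma> = 1) \<and> (\<forall>e\<in>edges \<C>. half_sq_length q e = y e)"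
proof -
  obtain p a where p: "\<And>k u v. {u, v} \<in> edges \<C> \<Longrightarrow> (u - v) \<bullet> (p k u - p k v) = of_bool (k = Inl {u, v})"
    and a: "\<And>k v \<sigma>. (v, \<sigma>) \<in> Inc \<Longrightarrow> v \<bullet> a k \<sigma> + p k v \<bullet> N \<sigma> = of_bool (k = Inr (v, \<sigma>))"
    by (rule linearized_right_inverse[OF rigid]) (rule that, fast+)
  define K where "K = edges \<C> <+> Inc"
  have fin: "finite K" using finite_edges finite_Inc by (simp add: K_def)
  \<comment> \<open>\<open>M - 1\<close> is the sum of the norms of all column entries, so
    coefficients bounded by \<open>\<eta> / M\<close> displace every vertex and normal by strictly
    less than \<open>\<eta>\<close>.\<close>
  define M where "M = (\<Sum>k\<in>K. (\<Sum>v\<in>V. norm (p k v)) + (\<Sum>\<sigma>\<in>Fs. norm (a k \<sigma>))) + 1"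
  have M: "M > 0" unfolding M_def by (intro add_nonneg_pos sum_nonneg add_nonneg_nonneg) auto
  \<comment> \<open>the quadratic part of the constraint \<open>k\<close>, evaluated on the \<open>i\<close>-th and \<open>j\<close>-th column of the right
    inverse; \<open>THE\<close> only removes the choice of an ordering of the edge\<close>
  define c where "c k i j = (case k of
      Inl e \<Rightarrow> (1/2) * (THE r. \<exists>u v. e = {u, v} \<and> r = (p i u - p i v) \<bullet> (p j u - p j v))
    | Inr (v, \<sigma>) \<Rightarrow> p i v \<bullet> a j \<sigma>)" for k i j
  have c_edge: "c (Inl {u, v}) i j = (1/2) * ((p i u - p i v) \<bullet> (p j u - p j v))" for u v i j
  proof -
    have "(THE r. \<exists>u' v'. {u, v} = {u', v'} \<and> r = (p i u' - p i v') \<bullet> (p j u' - p j v')) =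
        (p i u - p i v) \<bullet> (p j u - p j v)"
      by (rule the_equality) (auto simp: doubleton_eq_iff inner_diff_left inner_diff_right)
    then show ?thesis by (simp add: c_def)
  qed
  have c_inc: "c (Inr (v, \<sigma>)) i j = p i v \<bullet> a j \<sigma>" for v \<sigma> i j by (simp add: c_def)
  have "\<eta> / M > 0" using \<open>\<eta> > 0\<close> M by simp
  from quadratic_perturbation_solvable[OF fin this, of c]
  obtain \<delta> where \<delta>: "\<delta> > 0" and solve: "\<forall>y. (\<forall>k\<in>K. \<bar>y k\<bar> < \<delta>) \<longrightarrow>
      (\<exists>u. \<forall>k\<in>K. \<bar>u k\<bar> \<le> \<eta> / M \<and> u k + (\<Sum>i\<in>K. \<Sum>j\<in>K. c k i j * u i * u j) = y k)"
    by (elim exE conjE) (rule that)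
  show ?thesis
  proof (rule that[OF \<delta>])
    fix y assume y: "\<And>e. e \<in> edges \<C> \<Longrightarrow> \<bar>y e - half_sq_length id e\<bar> < \<delta>"
    \<comment> \<open>Edge rows must change by the difference to the target length; incidence rows
      must keep their value 1.\<close>
    define y' where "y' k = (case k of Inl e \<Rightarrow> y e - half_sq_length id e | Inr _ \<Rightarrow> 0)"
      for k :: "(real^3) set + (real^3) \<times> (real^3) set"
    have "\<forall>k\<in>K. \<bar>y' k\<bar> < \<delta>" using y \<delta> by (auto simp: K_def y'_def)
    from solve[rule_format, OF this[rule_format]]
    obtain u where u: "\<forall>k\<in>K. \<bar>u k\<bar> \<le> \<eta> / M \<and> u k + (\<Sum>i\<in>K. \<Sum>j\<in>K. c k i j * u i * u j) = y' k" ..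
    have u_le: "\<bar>u k\<bar> \<le> \<eta> / M"
      and u_eq: "u k + (\<Sum>i\<in>K. \<Sum>j\<in>K. c k i j * u i * u j) = y' k" if "k \<in> K" for k
      using bspec[OF u that] by simp_all
    define dp where "dp v = (\<Sum>k\<in>K. u k *\<^sub>R p k v)" for v
    define da where "da \<sigma> = (\<Sum>k\<in>K. u k *\<^sub>R a k \<sigma>)" for \<sigma>
    have small: "norm (\<Sum>k\<in>K. u k *\<^sub>R x k) < \<eta>"
      if "\<And>k. k \<in> K \<Longrightarrow> norm (x k) \<le> (\<Sum>v\<in>V. norm (p k v)) + (\<Sum>\<sigma>\<in>Fs. norm (a k \<sigma>))" for x :: "_ \<Rightarrow> real^3"
    proof -
      have "norm (\<Sum>k\<in>K. u k *\<^sub>R x k) \<le> (\<Sum>k\<in>K. \<bar>u k\<bar> * norm (x k))"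
        by (intro order.trans[OF norm_sum] sum_mono) simp
      also have "\<dots> \<le> (\<Sum>k\<in>K. \<eta> / M * norm (x k))" by (intro sum_mono mult_right_mono u_le) auto
      also have "\<dots> = \<eta> / M * (\<Sum>k\<in>K. norm (x k))" by (simp only: sum_distrib_left)
      also have "\<dots> \<le> \<eta> / M * (M - 1)"
        unfolding M_def using \<open>\<eta> / M > 0\<close> that M_def by (intro mult_left_mono) (auto intro!: sum_mono)
      also have "\<dots> < \<eta>" using M \<open>\<eta> > 0\<close> by (simp add: field_simps)
      finally show ?thesis .
    qed
    have dp_small: "norm (dp v) < \<eta>" if "v \<in> V" for v
      unfolding dp_def
    proof (rule small)
      show "norm (p k v) \<le> (\<Sum>v\<in>V. norm (p k v)) + (\<Sum>\<sigma>\<in>Fs. norm (a k \<sigma>))" for k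
        using member_le_sum[of v V "\<lambda>v. norm (p k v)"] that finite_V
        by (intro add_increasing2 sum_nonneg) auto
    qed
    have da_small: "norm (da \<sigma>) < \<eta>" if "\<sigma> \<in> Fs" for \<sigma>
      unfolding da_def
    proof (rule small)
      show "norm (a k \<sigma>) \<le> (\<Sum>v\<in>V. norm (p k v)) + (\<Sum>\<sigma>\<in>Fs. norm (a k \<sigma>))" for k
        using member_le_sum[of \<sigma> Fs "\<lambda>\<sigma>. norm (a k \<sigma>)"] that finite_Fs
        by (intro add_increasing sum_nonneg) auto
    qed
    have pick: "(\<Sum>i\<in>K. u i * of_bool (i = k)) = u k" if "k \<in> K" for k
      using fin that by (simp add: of_bool_def if_distrib[of "(*) _"] cong: if_cong)
    have quad: "(\<Sum>i\<in>K. u i *\<^sub>R x i) \<bullet> (\<Sum>j\<in>K. u j *\<^sub>R z j) = (\<Sum>i\<in>K. \<Sum>j\<in>K. (x i \<bullet> z j) * u i * u j)"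
      for x z :: "_ \<Rightarrow> real^3"
      unfolding inner_sum_left by (simp add: inner_sum_right sum_distrib_left mult.commute mult.left_commute)
    have edge: "half_sq_length (\<lambda>v. v + dp v) e = y e" if e_in: "e \<in> edges \<C>" for e
    proof -
      obtain v w where e: "e = {v, w}" using e_in by (auto simp: edges_eq)
      have k: "Inl e \<in> K" using e_in by (auto simp: K_def)
      have diff: "dp v - dp w = (\<Sum>k\<in>K. u k *\<^sub>R (p k v - p k w))"
        by (simp add: dp_def sum_subtractf scaleR_diff_right)
      have "(v - w) \<bullet> (dp v - dp w) = (\<Sum>k\<in>K. u k * ((v - w) \<bullet> (p k v - p k w)))"
        by (simp only: diff inner_sum_right inner_scaleR_right)
      also have "\<dots> = u (Inl e)" using p[of v w] e_in pick[OF k] by (simp add: e)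
      finally have lin: "(v - w) \<bullet> (dp v - dp w) = u (Inl e)" .
      have qu: "(1/2) * ((dp v - dp w) \<bullet> (dp v - dp w)) = (\<Sum>i\<in>K. \<Sum>j\<in>K. c (Inl e) i j * u i * u j)"
        unfolding diff quad e c_edge by (simp add: sum_distrib_left mult.assoc)
      \<comment> \<open>Expanding the square gives the old length, the linear part
        \<open>u (Inl e)\<close> and the quadratic part \<open>Q\<close>; the last two add up to
        \<open>y' (Inl e)\<close>.\<close>
      have "half_sq_length (\<lambda>v. v + dp v) e = (1/2) * (((v - w) + (dp v - dp w)) \<bullet> ((v - w) + (dp v - dp w)))"
        unfolding e half_sq_length_pair by (simp add: power2_norm_eq_inner algebra_simps)
      also have "\<dots> = half_sq_length id e + (v - w) \<bullet> (dp v - dp w) + (1/2) * ((dp v - dp w) \<bullet> (dp v - dp w))"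
        unfolding e half_sq_length_pair power2_norm_eq_inner inner_add_left inner_add_right
        by (simp add: inner_commute)
      also have "\<dots> = half_sq_length id e + y' (Inl e)" using u_eq[OF k] lin qu by simp
      finally show ?thesis by (simp add: y'_def)
    qed
    have inc: "(v + dp v) \<bullet> (N \<sigma> + da \<sigma>) = 1" if i: "(v, \<sigma>) \<in> Inc" for v \<sigma>
    proof -
      have k: "Inr (v, \<sigma>) \<in> K" using i by (auto simp: K_def)
      \<comment> \<open>In the same way the product expands to 1 plus a linear and a quadratic part,
        whose sum is \<open>y' (Inr (v, \<sigma>)) = 0\<close>.\<close>
      have "v \<bullet> da \<sigma> + dp v \<bullet> N \<sigma> = (\<Sum>k\<in>K. u k * (v \<bullet> a k \<sigma> + p k v \<bullet> N \<sigma>))"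
        by (simp add: dp_def da_def inner_sum_left inner_sum_right sum.distrib distrib_left)
      also have "\<dots> = u (Inr (v, \<sigma>))" using a[OF i] pick[OF k] by simp
      finally have lin: "v \<bullet> da \<sigma> + dp v \<bullet> N \<sigma> = u (Inr (v, \<sigma>))" .
      have "dp v \<bullet> da \<sigma> = (\<Sum>i\<in>K. \<Sum>j\<in>K. c (Inr (v, \<sigma>)) i j * u i * u j)"
        unfolding dp_def da_def quad c_inc ..
      then have "u (Inr (v, \<sigma>)) + dp v \<bullet> da \<sigma> = 0" using u_eq[OF k] by (simp add: y'_def)
      moreover have "N \<sigma> \<bullet> v = 1" using i facet(7)[of \<sigma> v] vertex_in_P[of v] by simp
      ultimately show ?thesis using lin by (simp add: inner_add_left inner_add_right inner_commute)
    qed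
    show "\<exists>q b. (\<forall>v\<in>V. q v \<in> ball v \<eta>) \<and> (\<forall>\<sigma>\<in>Fs. b \<sigma> \<in> ball (N \<sigma>) \<eta>) \<and>
        (\<forall>(v, \<sigma>)\<in>Inc. q v \<bullet> b \<sigma> = 1) \<and> (\<forall>e\<in>edges \<C>. half_sq_length q e = y e)"
      by (intro exI[of _ "\<lambda>v. v + dp v"] exI[of _ "\<lambda>\<sigma>. N \<sigma> + da \<sigma>"] conjI ballI)
        (use dp_small da_small edge inc in \<open>auto simp: dist_norm\<close>)
  qed
qed

lemma half_sq_length_cong:
  assumes "e \<in> edges \<C>" "\<And>v. v \<in> V \<Longrightarrow> p v = q v"
  shows "half_sq_length p e = half_sq_length q e"
proof -
  obtain u v where e: "e = {u, v}" using assms(1) by (auto simp: edges_eq)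
  then show ?thesis using assms edge_ends_in_V[of u v] by (simp add: half_sq_length_pair)
qed

lemma all_edge_length_perturbations_of_rigid:
  assumes rigid: "first_order_rigid P"
  shows "has_all_edge_length_perturbations P"
  unfolding has_all_edge_length_perturbations_def locally_surjective_at_def
proof (intro allI impI)
  fix U assume "neighbourhood_in (realization_topology \<C>) (polytope_config P) U"
  then obtain W where W: "openin (realization_topology \<C>) W" "polytope_config P \<in> W" "W \<subseteq> U"
    unfolding neighbourhood_in_def by blast
  obtain \<eta> where \<eta>: "\<eta> > 0" and box: "\<And>q b. q \<in> (\<Pi>\<^sub>E v\<in>V. ball (restrict (\<lambda>v. v) V v) \<eta>) \<Longrightarrow>
      b \<in> (\<Pi>\<^sub>E \<sigma>\<in>Fs. ball (restrict N Fs \<sigma>) \<eta>) \<Longrightarrow>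
      (\<And>v \<sigma>. v \<in> V \<Longrightarrow> \<sigma> \<in> Fs \<Longrightarrow> v \<in> \<sigma> \<Longrightarrow> q v \<bullet> b \<sigma> = 1) \<Longrightarrow> (q, b) \<in> W"
    using realization_topology_nhd_box[of \<C> W "restrict (\<lambda>v. v) V" "restrict N Fs"] W finite_V finite_Fs
    unfolding polytope_config_eq polytope_type_sel by blast
  obtain \<delta> where \<delta>: "\<delta> > 0" and perturb: "\<And>y. (\<And>e. e \<in> edges \<C> \<Longrightarrow> \<bar>y e - half_sq_length id e\<bar> < \<delta>) \<Longrightarrow>
      \<exists>q b. (\<forall>v\<in>V. q v \<in> ball v \<eta>) \<and> (\<forall>\<sigma>\<in>Fs. b \<sigma> \<in> ball (N \<sigma>) \<eta>) \<and>
        (\<forall>(v, \<sigma>)\<in>Inc. q v \<bullet> b \<sigma> = 1) \<and> (\<forall>e\<in>edges \<C>. half_sq_length q e = y e)"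
    using perturbations_of_rigid[OF rigid \<eta>] by blast
  let ?l = "\<lambda>e\<in>edges \<C>. half_sq_length id e"
  \<comment> \<open>The open box of edge lengths within \<open>\<delta>\<close> of the present ones;
    finiteness of the edge set makes it open in the product topology.\<close>
  let ?N = "\<Pi>\<^sub>E e\<in>edges \<C>. ball (half_sq_length id e) \<delta>"
  let ?Y = "product_topology (\<lambda>_. euclideanreal) (edges \<C>)"
  have l: "edge_length_map \<C> (polytope_config P) = ?l"
    unfolding edge_length_map_def polytope_config_eq prod.case
    by (intro restrict_ext half_sq_length_cong) simp_all
  have "openin ?Y ?N"
    using finite_edges by (auto simp: openin_PiE_gen open_openin[symmetric])
  moreover have "?l \<in> ?N" using \<delta> by auto
  ultimately have nhd: "neighbourhood_in ?Y ?l ?N"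
    unfolding neighbourhood_in_def using openin_subset by blast
  have "?N \<subseteq> edge_length_map \<C> ` U"
  proof
    fix y assume y: "y \<in> ?N"
    have "\<bar>y e - half_sq_length id e\<bar> < \<delta>" if "e \<in> edges \<C>" for e
      using PiE_mem[OF y that] by (simp add: dist_real_def abs_minus_commute)
    from perturb[of y, OF this] obtain q b where qb: "\<And>v. v \<in> V \<Longrightarrow> q v \<in> ball v \<eta>"
      "\<And>\<sigma>. \<sigma> \<in> Fs \<Longrightarrow> b \<sigma> \<in> ball (N \<sigma>) \<eta>" "\<And>v \<sigma>. (v, \<sigma>) \<in> Inc \<Longrightarrow> q v \<bullet> b \<sigma> = 1"
      and len: "\<And>e. e \<in> edges \<C> \<Longrightarrow> half_sq_length q e = y e" by blast
    \<comment> \<open>Restriction makes the solution a point of the realization space and leaves the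
      edge lengths unchanged, as all end points of edges lie in \<open>V\<close>.\<close>
    have "(restrict q V, restrict b Fs) \<in> W"
      by (rule box) (use qb in auto)
    moreover have "edge_length_map \<C> (restrict q V, restrict b Fs) = y"
    proof (rule extensionalityI)
      show "edge_length_map \<C> (restrict q V, restrict b Fs) \<in> extensional (edges \<C>)"
        by (simp add: edge_length_map_def)
      show "y \<in> extensional (edges \<C>)" using y by (simp add: PiE_def)
      fix e assume e: "e \<in> edges \<C>"
      have "half_sq_length (restrict q V) e = half_sq_length q e" using e by (rule half_sq_length_cong) simp
      then show "edge_length_map \<C> (restrict q V, restrict b Fs) e = y e"
        using len e by (simp add: edge_length_map_def)
    qed
    ultimately show "y \<in> edge_length_map \<C> ` U" using W(3) by blast
  qed
  with nhd show "\<exists>N'. neighbourhood_in ?Y (edge_length_map \<C> (polytope_config P)) N' \<and> N' \<subseteq> edge_length_map \<C> ` U"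
    unfolding l by blast
qed

end

theorem proposition5p3:
  fixes P :: "(real^3) set"
  assumes "polytope P" and "aff_dim P = 3" and "0 \<in> interior P"
    and "first_order_rigid P"
  shows "has_all_edge_length_perturbations P"
proof -
  interpret polytope3 P by unfold_locales fact+
  show ?thesis by (rule all_edge_length_perturbations_of_rigid[OF assms(4)])
qed

end
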